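(* Let $R$ be a commutative ring with unit, let $Z$ be a paracompact Hausdorff space and let $g\colon Z\to Z$ be a continuous map having a single point $a\in Z$ as a global, asymptotically stable attractor. For each $q\ge0$ and each formal power series $A(x)=\sum_{j\ge0}a_jx^j\in R[[x]]$, let $A(g^* )\colon\check H^q(Z,a;R)\to\check H^q(Z,a;R)$ be the endomorphism $u\mapsto\sum_{j=0}^\infty a_j(g^* )^j(u)$. Then for any two series $A,B\in R[[x]]$ one has $$(A+B)(g^* )=A(g^* )+B(g^* )\qquad\text{and}\qquad (AB)(g^* )=A(g^* )\,B(g^* ),$$ where the product on the right is composition of endomorphisms.
   Context: That $a$ is a global asymptotically stable attractor means: $a$ has a neighbourhood basis of positively invariant sets $P$ ($g(P)\subseteq P$; in particular $g(a)=a$), and for every $p\in Z$ and every neighbourhood $P$ of $a$ there is $n_0$ with $g^{n_0}(p)\in P$. Alexander–Spanier cohomology. $\check H^q(Z,a;R)$ is defined as follows. $C^q(Z,a)$ is the $R$-module of all (set-theoretic) maps $\xi\colon Z^{q+1}\to R$ with $\xi(a,\ldots,a)=0$ (and $C^q(Z,a)=0$ for $q<0$), with coboundary $\partial\xi(z_0,\ldots,z_{q+1})=\sum_{j=0}^{q+1}(-1)^j\xi(z_0,\ldots,\hat z_j,\ldots,z_{q+1})$. A map $\xi$ is locally zero if it vanishes on a neighbourhood of the diagonal of $Z^{q+1}$; $\overline C^q(Z,a)$ is the quotient of $C^q(Z,a)$ by the locally zero maps, and $\check H^q(Z,a;R)$ is the cohomology of the complex $(\overline C^*(Z,a),\overline\partial)$.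 If $\partial\xi$ is locally zero, $[\overline\xi]$ denotes the class represented by $\xi$. Sum of series. Every class $u\in\check H^q(Z,a;R)$ has a representative $\xi\in C^q(Z,a)$ vanishing on $P^{q+1}$ for some neighbourhood $P$ of $a$. For coefficients $a_j\in R$ and such $\xi$ set $S(\xi)(z_0,\ldots,z_q)=\sum_{j=0}^\infty a_j\,\xi(g^j(z_0),\ldots,g^j(z_q))$, which is a finite sum for each fixed tuple. Then $\partial S(\xi)$ is locally zero, the class $[\overline{S(\xi)}]$ depends only on $u$ and $(a_j)$, and one defines $\sum_{j=0}^\infty a_j(g^* )^j(u):=[\overline{S(\xi)}]$. Power series are added and multiplied in the usual formal way. *)

theory Defs
  imports "HOL-Analysis.Analysis" "HOL-Algebra.Coset"
    "HOL-Computational_Algebra.Formal_Power_Series" "HOL-Library.Groups_Big_Fun"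
begin

definition paracompact_space :: "'z topology \<Rightarrow> bool" where
  "paracompact_space Z \<longleftrightarrow>
     (\<forall>\<U>. (\<forall>U\<in>\<U>. openin Z U) \<and> \<Union>\<U> = topspace Z \<longrightarrow>
        (\<exists>\<V>. (\<forall>V\<in>\<V>. openin Z V) \<and> \<Union>\<V> = topspace Z \<and>
              (\<forall>V\<in>\<V>. \<exists>U\<in>\<U>. V \<subseteq> U) \<and> locally_finite_in Z \<V>))"

definition global_asymptotically_stable_attractor ::
    "'z topology \<Rightarrow> ('z \<Rightarrow> 'z) \<Rightarrow> 'z \<Rightarrow> bool" where
  "global_asymptotically_stable_attractor Z g a \<longleftrightarrow>
     a \<in> topspace Z \<and>
     neighbourhood_base_at a (\<lambda>P. g ` P \<subseteq> P) Z \<and>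
     (\<forall>p\<in>topspace Z. \<forall>P. a \<in> Z interior_of P \<longrightarrow> (\<exists>n. (g ^^ n) p \<in> P))"

text \<open>
  Points of the power \<open>Z\<^sup>q\<^sup>+\<^sup>1\<close> are extensional functions on the index set \<open>{..q}\<close>.
\<close>

definition tuple_space :: "'z topology \<Rightarrow> nat \<Rightarrow> (nat \<Rightarrow> 'z) topology" where
  "tuple_space Z q = product_topology (\<lambda>_. Z) {..q}"

definition const_tuple :: "nat \<Rightarrow> 'z \<Rightarrow> nat \<Rightarrow> 'z" where
  "const_tuple q z = (\<lambda>i\<in>{..q}. z)"

text \<open>
  Omitting entry \<open>j\<close> of a tuple with entries \<open>0, \<dots>, q + 1\<close>.
\<close>

definition omit_entry :: "nat \<Rightarrow> nat \<Rightarrow> (nat \<Rightarrow> 'z) \<Rightarrow> nat \<Rightarrow> 'z" where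
  "omit_entry q j z = (\<lambda>i\<in>{..q}. if i < j then z i else z (Suc i))"

text \<open>
  The additive groups below are written as multiplicative records, as for the homology groups of
  \<open>HOL-Homology\<close>. Commutative rings with unit are the types of sort \<open>{comm_ring, monoid_mult}\<close>:
  unlike the class \<open>comm_ring_1\<close>, this does not exclude the zero ring.
\<close>

definition AS_cochain_group ::
    "'z topology \<Rightarrow> 'z \<Rightarrow> nat \<Rightarrow> ((nat \<Rightarrow> 'z) \<Rightarrow> 'r::{comm_ring,monoid_mult}) monoid" where
  "AS_cochain_group Z a q =
     \<lparr>carrier = {\<xi> \<in> extensional (topspace (tuple_space Z q)). \<xi> (const_tuple q a) = 0},
      mult = (\<lambda>\<xi> \<eta>. \<lambda>z\<in>topspace (tuple_space Z q). \<xi> z + \<eta> z),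
      one = (\<lambda>z\<in>topspace (tuple_space Z q). 0)\<rparr>"

definition AS_coboundary ::
    "'z topology \<Rightarrow> nat \<Rightarrow> ((nat \<Rightarrow> 'z) \<Rightarrow> 'r::{comm_ring,monoid_mult}) \<Rightarrow> (nat \<Rightarrow> 'z) \<Rightarrow> 'r" where
  "AS_coboundary Z q \<xi> =
     (\<lambda>z\<in>topspace (tuple_space Z (Suc q)). \<Sum>j\<le>Suc q. (- 1) ^ j * \<xi> (omit_entry q j z))"

definition locally_zero_cochains ::
    "'z topology \<Rightarrow> 'z \<Rightarrow> nat \<Rightarrow> ((nat \<Rightarrow> 'z) \<Rightarrow> 'r::{comm_ring,monoid_mult}) set" where
  "locally_zero_cochains Z a q =
     {\<xi> \<in> carrier (AS_cochain_group Z a q).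
        \<exists>N. openin (tuple_space Z q) N \<and> const_tuple q ` topspace Z \<subseteq> N \<and> (\<forall>z\<in>N. \<xi> z = 0)}"

definition AS_quotient_group ::
    "'z topology \<Rightarrow> 'z \<Rightarrow> nat \<Rightarrow> ((nat \<Rightarrow> 'z) \<Rightarrow> 'r::{comm_ring,monoid_mult}) set monoid" where
  "AS_quotient_group Z a q = AS_cochain_group Z a q Mod locally_zero_cochains Z a q"

text \<open>
  The coboundary of the quotient complex. All members of a coset \<open>X\<close> of the locally zero cochains
  contribute the same coset to the union.
\<close>

definition AS_quotient_coboundary ::
    "'z topology \<Rightarrow> 'z \<Rightarrow> nat \<Rightarrow> ((nat \<Rightarrow> 'z) \<Rightarrow> 'r::{comm_ring,monoid_mult}) set
       \<Rightarrow> ((nat \<Rightarrow> 'z) \<Rightarrow> 'r) set" where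
  "AS_quotient_coboundary Z a q X =
     (\<Union>\<xi>\<in>X. locally_zero_cochains Z a (Suc q) #>\<^bsub>AS_cochain_group Z a (Suc q)\<^esub> AS_coboundary Z q \<xi>)"

definition AS_cocycle_group ::
    "'z topology \<Rightarrow> 'z \<Rightarrow> nat \<Rightarrow> ((nat \<Rightarrow> 'z) \<Rightarrow> 'r::{comm_ring,monoid_mult}) set monoid" where
  "AS_cocycle_group Z a q =
     (AS_quotient_group Z a q)
       \<lparr>carrier := kernel (AS_quotient_group Z a q) (AS_quotient_group Z a (Suc q))
                    (AS_quotient_coboundary Z a q)\<rparr>"

text \<open>
  In degree 0 the coboundaries are trivial because the complex is zero in negative degrees.
\<close>

definition AS_coboundaries ::
    "'z topology \<Rightarrow> 'z \<Rightarrow> nat \<Rightarrow> ((nat \<Rightarrow> 'z) \<Rightarrow> 'r::{comm_ring,monoid_mult}) set set" where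
  "AS_coboundaries Z a q =
     (case q of
        0 \<Rightarrow> {\<one>\<^bsub>AS_quotient_group Z a 0\<^esub>}
      | Suc p \<Rightarrow> AS_quotient_coboundary Z a p ` carrier (AS_quotient_group Z a p))"

definition AS_cohomology ::
    "'z topology \<Rightarrow> 'z \<Rightarrow> nat \<Rightarrow> ((nat \<Rightarrow> 'z) \<Rightarrow> 'r::{comm_ring,monoid_mult}) set set monoid" where
  "AS_cohomology Z a q = AS_cocycle_group Z a q Mod AS_coboundaries Z a q"

text \<open>
  The class in cohomology of a cochain \<open>\<xi>\<close> whose coboundary is locally zero.
\<close>

definition AS_class ::
    "'z topology \<Rightarrow> 'z \<Rightarrow> nat \<Rightarrow> ((nat \<Rightarrow> 'z) \<Rightarrow> 'r::{comm_ring,monoid_mult})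
       \<Rightarrow> ((nat \<Rightarrow> 'z) \<Rightarrow> 'r) set set" where
  "AS_class Z a q \<xi> =
     AS_coboundaries Z a q #>\<^bsub>AS_cocycle_group Z a q\<^esub>
       (locally_zero_cochains Z a q #>\<^bsub>AS_cochain_group Z a q\<^esub> \<xi>)"

text \<open>
  \<^const>\<open>Sum_any\<close> is the sum of a family with finitely many nonzero terms; for a cochain
  vanishing on \<open>P\<^sup>q\<^sup>+\<^sup>1\<close> with \<open>P\<close> a neighbourhood of the attractor the family is of this kind.
\<close>

definition series_cochain ::
    "'z topology \<Rightarrow> ('z \<Rightarrow> 'z) \<Rightarrow> nat \<Rightarrow> 'r::{comm_ring,monoid_mult} fps
       \<Rightarrow> ((nat \<Rightarrow> 'z) \<Rightarrow> 'r) \<Rightarrow> (nat \<Rightarrow> 'z) \<Rightarrow> 'r" where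
  "series_cochain Z g q A \<xi> =
     (\<lambda>z\<in>topspace (tuple_space Z q).
        Sum_any (\<lambda>j. fps_nth A j * \<xi> (\<lambda>i\<in>{..q}. (g ^^ j) (z i))))"

definition representatives_vanishing_near ::
    "'z topology \<Rightarrow> 'z \<Rightarrow> nat \<Rightarrow> ((nat \<Rightarrow> 'z) \<Rightarrow> 'r::{comm_ring,monoid_mult}) set set
       \<Rightarrow> ((nat \<Rightarrow> 'z) \<Rightarrow> 'r) set" where
  "representatives_vanishing_near Z a q u =
     {\<xi> \<in> carrier (AS_cochain_group Z a q).
        AS_coboundary Z q \<xi> \<in> locally_zero_cochains Z a (Suc q) \<and>
        AS_class Z a q \<xi> = u \<and>
        (\<exists>P \<subseteq> topspace Z. a \<in> Z interior_of P \<and> (\<forall>z \<in> {..q} \<rightarrow>\<^sub>E P. \<xi> z = 0))}"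

text \<open>
  The value \<open>A(g\<^sup>*)(u)\<close>. For an attractor \<open>a\<close> of \<open>g\<close> the class described here exists and does not
  depend on the representative.
\<close>

definition power_series_operator ::
    "'z topology \<Rightarrow> ('z \<Rightarrow> 'z) \<Rightarrow> 'z \<Rightarrow> nat \<Rightarrow> 'r::{comm_ring,monoid_mult} fps
       \<Rightarrow> ((nat \<Rightarrow> 'z) \<Rightarrow> 'r) set set \<Rightarrow> ((nat \<Rightarrow> 'z) \<Rightarrow> 'r) set set" where
  "power_series_operator Z g a q A u =
     (THE c. \<exists>\<xi> \<in> representatives_vanishing_near Z a q u. c = AS_class Z a q (series_cochain Z g q A \<xi>))"

end

theory Submission
  imports Defs
begin

text \<open>
  For a cochain \<open>\<xi>\<close> that vanishes near \<open>a\<close>, write \<open>S\<^sub>A \<xi>\<close> for the series of iterates of \<open>\<xi>\<close> with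
  coefficients \<open>A\<close>. Every tuple is eventually carried into a positively invariant neighbourhood of
  \<open>a\<close> on which \<open>\<xi>\<close> vanishes, so at each tuple \<open>S\<^sub>A \<xi>\<close> is a finite sum, and \<open>S\<^sub>A \<xi>\<close> again vanishes near
  \<open>a\<close>. On such cochains both identities hold before passing to cohomology:
  \<open>S\<^sub>A\<^sub>+\<^sub>B \<xi> = S\<^sub>A \<xi> + S\<^sub>B \<xi>\<close> termwise, and \<open>S\<^sub>A (S\<^sub>B \<xi>) = S\<^sub>A\<^sub>B \<xi>\<close> by collecting the terms
  \<open>a\<^sub>j b\<^sub>k \<xi> \<circ> g\<^sup>j\<^sup>+\<^sup>k\<close> according to \<open>j + k\<close> (\<open>series_of_fps_sum\<close>, \<open>series_of_fps_product\<close>).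

  It remains to see that the class of \<open>S\<^sub>A \<xi>\<close> depends only on the class of \<open>\<xi>\<close>. The series commutes with
  the coboundary (\<open>coboundary_series\<close>) and preserves local vanishing (\<open>series_locally_zero\<close>), by
  continuity of the iterates of \<open>g\<close>. If two representatives differ by a coboundary \<open>\<delta> \<eta>\<close> up to a
  locally zero cochain, then \<open>\<delta> \<eta>\<close> vanishes near \<open>a\<close>, but \<open>\<eta>\<close> may not, and the series of \<open>\<eta>\<close> would be
  meaningless. The cone with apex \<open>a\<close> repairs this: near \<open>a\<close> it writes any cocycle as the coboundary
  of a globally defined cochain (\<open>cocycle_near_basepoint_is_exact\<close>), and subtracting that coboundary
  makes \<open>\<eta>\<close> vanish near \<open>a\<close> without changing \<open>\<delta> \<eta>\<close>. The same lemma shows that every class has a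
  representative vanishing near \<open>a\<close>.
\<close>

section \<open>Cochains on a pointed space\<close>

text \<open>
  The two vanishing conditions on cochains are instances of this one: a cochain is locally zero if
  it vanishes near every point, and the series is formed from cochains that vanish near \<open>a\<close>.
\<close>

definition vanishes_near :: "'z topology \<Rightarrow> nat \<Rightarrow> 'z \<Rightarrow> ((nat \<Rightarrow> 'z) \<Rightarrow> 'r::zero) \<Rightarrow> bool" where
  "vanishes_near Z q z \<xi> \<longleftrightarrow>
     (\<exists>U. openin Z U \<and> z \<in> U \<and> (\<forall>t \<in> {..q} \<rightarrow>\<^sub>E U. \<xi> t = 0))"

lemma topspace_tuple_space: "topspace (tuple_space Z q) = ({..q} \<rightarrow>\<^sub>E topspace Z)"
  by (simp add: tuple_space_def)

lemma const_tuple_in_PiE: "z \<in> U \<Longrightarrow> const_tuple q z \<in> {..q} \<rightarrow>\<^sub>E U"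
  by (auto simp: const_tuple_def)

lemma omit_entry_in_PiE: "t \<in> {..Suc q} \<rightarrow>\<^sub>E U \<Longrightarrow> omit_entry q j t \<in> {..q} \<rightarrow>\<^sub>E U"
  by (auto simp: omit_entry_def PiE_iff)

lemma omit_entry_const_tuple: "omit_entry q j (const_tuple (Suc q) z) = const_tuple q z"
  by (auto simp: omit_entry_def const_tuple_def)

text \<open>
  Intersecting the two neighbourhoods; in this form vanishing near a point passes to sums and
  differences of cochains by a computation at a single tuple.
\<close>

lemma vanishes_near_combine:
  assumes "vanishes_near Z q z \<xi>" "vanishes_near Z q z \<eta>"
    and imp: "\<And>t. t \<in> {..q} \<rightarrow>\<^sub>E topspace Z \<Longrightarrow> \<xi> t = 0 \<Longrightarrow> \<eta> t = 0 \<Longrightarrow> \<zeta> t = 0"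
  shows "vanishes_near Z q z \<zeta>"
proof -
  obtain U where U: "openin Z U" "z \<in> U" "\<And>t. t \<in> {..q} \<rightarrow>\<^sub>E U \<Longrightarrow> \<xi> t = 0"
    using assms(1) by (auto simp: vanishes_near_def)
  obtain V where V: "openin Z V" "z \<in> V" "\<And>t. t \<in> {..q} \<rightarrow>\<^sub>E V \<Longrightarrow> \<eta> t = 0"
    using assms(2) by (auto simp: vanishes_near_def)
  have "\<zeta> t = 0" if t: "t \<in> {..q} \<rightarrow>\<^sub>E U \<inter> V" for t
  proof (rule imp)
    show "t \<in> {..q} \<rightarrow>\<^sub>E topspace Z"
      using t openin_subset[OF U(1)] by (auto simp: PiE_iff)
    show "\<xi> t = 0" "\<eta> t = 0"
      using t by (auto intro!: U(3) V(3) elim!: subsetD[OF PiE_mono, rotated])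
  qed
  then show ?thesis
    using openin_Int[OF U(1) V(1)] U(2) V(2) by (auto simp: vanishes_near_def)
qed

lemma vanishes_near_iff_neighbourhood:
  "vanishes_near Z q z \<xi> \<longleftrightarrow>
     (\<exists>P \<subseteq> topspace Z. z \<in> Z interior_of P \<and> (\<forall>t \<in> {..q} \<rightarrow>\<^sub>E P. \<xi> t = 0))"
proof
  assume "vanishes_near Z q z \<xi>"
  then obtain U where "openin Z U" "z \<in> U" "\<forall>t \<in> {..q} \<rightarrow>\<^sub>E U. \<xi> t = 0"
    by (auto simp: vanishes_near_def)
  then show "\<exists>P \<subseteq> topspace Z. z \<in> Z interior_of P \<and> (\<forall>t \<in> {..q} \<rightarrow>\<^sub>E P. \<xi> t = 0)"
    by (intro exI[of _ U]) (auto simp: interior_of_openin dest: openin_subset)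
next
  assume "\<exists>P \<subseteq> topspace Z. z \<in> Z interior_of P \<and> (\<forall>t \<in> {..q} \<rightarrow>\<^sub>E P. \<xi> t = 0)"
  then obtain P where P: "z \<in> Z interior_of P" "\<And>t. t \<in> {..q} \<rightarrow>\<^sub>E P \<Longrightarrow> \<xi> t = 0"
    by blast
  have "\<xi> t = 0" if "t \<in> {..q} \<rightarrow>\<^sub>E Z interior_of P" for t
    using that interior_of_subset[of Z P] by (intro P(2)) (auto simp: PiE_iff)
  then show "vanishes_near Z q z \<xi>"
    using P(1) by (auto simp: vanishes_near_def intro!: exI[of _ "Z interior_of P"])
qed

text \<open>
  An open set containing the diagonal contains a box around each diagonal point; intersecting the
  finitely many sides of the box gives a cube. Conversely, the open cubes on which the cochain
  vanishes have an open union.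
\<close>

lemma vanishes_near_all_iff:
  "(\<forall>z \<in> topspace Z. vanishes_near Z q z \<xi>) \<longleftrightarrow>
     (\<exists>N. openin (tuple_space Z q) N \<and> const_tuple q ` topspace Z \<subseteq> N \<and> (\<forall>t\<in>N. \<xi> t = 0))"
proof
  assume near: "\<forall>z \<in> topspace Z. vanishes_near Z q z \<xi>"
  \<comment> \<open>The largest candidate: the union of all open cubes on which \<open>\<xi>\<close> vanishes.\<close>
  define N where "N = \<Union>{{..q} \<rightarrow>\<^sub>E U |U. openin Z U \<and> (\<forall>t \<in> {..q} \<rightarrow>\<^sub>E U. \<xi> t = 0)}"
  have "openin (tuple_space Z q) N"
    unfolding N_def tuple_space_def
    by (rule openin_Union) (auto simp: openin_PiE_gen)
  moreover have "const_tuple q ` topspace Z \<subseteq> N"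
  proof
    fix t assume "t \<in> const_tuple q ` topspace Z"
    then obtain z where z: "z \<in> topspace Z" "t = const_tuple q z" by blast
    then obtain U where "openin Z U" "z \<in> U" "\<forall>t \<in> {..q} \<rightarrow>\<^sub>E U. \<xi> t = 0"
      using near by (auto simp: vanishes_near_def)
    then show "t \<in> N"
      unfolding N_def z(2) using const_tuple_in_PiE[of z U q] by blast
  qed
  moreover have "\<forall>t\<in>N. \<xi> t = 0"
    unfolding N_def by blast
  ultimately show "\<exists>N. openin (tuple_space Z q) N \<and> const_tuple q ` topspace Z \<subseteq> N \<and> (\<forall>t\<in>N. \<xi> t = 0)"
    by blast
next
  assume "\<exists>N. openin (tuple_space Z q) N \<and> const_tuple q ` topspace Z \<subseteq> N \<and> (\<forall>t\<in>N. \<xi> t = 0)"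
  then obtain N where N: "openin (tuple_space Z q) N" "const_tuple q ` topspace Z \<subseteq> N"
    "\<forall>t\<in>N. \<xi> t = 0" by blast
  show "\<forall>z \<in> topspace Z. vanishes_near Z q z \<xi>"
  proof
    fix z assume "z \<in> topspace Z"
    then have "const_tuple q z \<in> N" using N(2) by blast
    then obtain W where W: "\<forall>i\<in>{..q}. openin Z (W i)"
      "const_tuple q z \<in> Pi\<^sub>E {..q} W" "Pi\<^sub>E {..q} W \<subseteq> N"
      using bspec[OF N(1)[unfolded tuple_space_def openin_product_topology_alt]] by meson
    define U where "U = (\<Inter>i\<in>{..q}. W i)"
    have "openin Z U"
      unfolding U_def using W(1) by (intro openin_Inter) auto
    moreover have "z \<in> U"
      using W(2) by (auto simp: U_def const_tuple_def PiE_iff)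
    moreover have "\<xi> t = 0" if "t \<in> {..q} \<rightarrow>\<^sub>E U" for t
    proof -
      have "t \<in> Pi\<^sub>E {..q} W" using that by (auto simp: U_def PiE_iff)
      then show ?thesis using W(3) N(3) by blast
    qed
    ultimately show "vanishes_near Z q z \<xi>"
      by (auto simp: vanishes_near_def)
  qed
qed

lemma vanishes_near_coboundary:
  fixes \<xi> :: "(nat \<Rightarrow> 'z) \<Rightarrow> 'r::{comm_ring,monoid_mult}"
  assumes "vanishes_near Z q z \<xi>"
  shows "vanishes_near Z (Suc q) z (AS_coboundary Z q \<xi>)"
proof -
  obtain U where U: "openin Z U" "z \<in> U" "\<And>t. t \<in> {..q} \<rightarrow>\<^sub>E U \<Longrightarrow> \<xi> t = 0"
    using assms by (auto simp: vanishes_near_def)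
  have "AS_coboundary Z q \<xi> t = 0" if t: "t \<in> {..Suc q} \<rightarrow>\<^sub>E U" for t
  proof -
    have "t \<in> {..Suc q} \<rightarrow>\<^sub>E topspace Z"
      using t PiE_mono[of "{..Suc q}" "\<lambda>_. U" "\<lambda>_. topspace Z"] openin_subset[OF U(1)] by blast
    moreover have "\<xi> (omit_entry q j t) = 0" for j
      using U(3) omit_entry_in_PiE[OF t] by blast
    ultimately show ?thesis
      by (simp add: AS_coboundary_def topspace_tuple_space del: sum.atMost_Suc)
  qed
  with U show ?thesis by (auto simp: vanishes_near_def)
qed

lemma omit_entry_omit_entry:
  assumes "i \<le> j"
  shows "omit_entry q j (omit_entry (Suc q) i t) = omit_entry q i (omit_entry (Suc q) (Suc j) t)"
proof
  fix k
  show "omit_entry q j (omit_entry (Suc q) i t) k = omit_entry q i (omit_entry (Suc q) (Suc j) t) k"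
  proof (cases "k \<le> q")
    case True
    consider "k < i" | "i \<le> k" "k < j" | "j \<le> k" by linarith
    then show ?thesis
      using True assms by cases (simp_all add: omit_entry_def)
  qed (simp add: omit_entry_def)
qed

text \<open>
  Two entries can be omitted in either order, so the terms of the double sum cancel in pairs:
  \<open>(i, j) \<mapsto> (j + 1, i)\<close> maps the pairs with \<open>i \<le> j\<close> bijectively onto those with \<open>j < i\<close>, keeps the
  face and changes the sign.
\<close>

lemma coboundary_coboundary:
  fixes \<xi> :: "(nat \<Rightarrow> 'z) \<Rightarrow> 'r::{comm_ring,monoid_mult}"
  assumes t: "t \<in> {..Suc (Suc q)} \<rightarrow>\<^sub>E topspace Z"
  shows "AS_coboundary Z (Suc q) (AS_coboundary Z q \<xi>) t = 0"
proof -
  define f :: "nat \<times> nat \<Rightarrow> 'r"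
    where "f = (\<lambda>(i, j). (- 1) ^ (i + j) * \<xi> (omit_entry q j (omit_entry (Suc q) i t)))"
  define Lo where "Lo = {(i, j). i \<le> j \<and> j \<le> Suc q}"
  define Up where "Up = {(i, j). j < i \<and> i \<le> Suc (Suc q)}"
  have un: "{..Suc (Suc q)} \<times> {..Suc q} = Lo \<union> Up" and disj: "Lo \<inter> Up = {}"
    by (auto simp: Lo_def Up_def)
  have "finite (Lo \<union> Up)"
    unfolding un[symmetric] by blast
  then have fin: "finite Lo" "finite Up"
    by blast+
  have "bij_betw (\<lambda>(i, j). (Suc j, i)) Lo Up"
    by (rule bij_betw_byWitness[where f' = "\<lambda>(i, j). (j, i - 1)"]) (auto simp: Lo_def Up_def)
  then have "sum f Up = (\<Sum>p\<in>Lo. f (case p of (i, j) \<Rightarrow> (Suc j, i)))"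
    by (rule sum.reindex_bij_betw[symmetric])
  also have "\<dots> = (\<Sum>p\<in>Lo. - f p)"
  proof (rule sum.cong[OF refl], clarify)
    fix i j assume "(i, j) \<in> Lo"
    then have "omit_entry q j (omit_entry (Suc q) i t) = omit_entry q i (omit_entry (Suc q) (Suc j) t)"
      by (simp add: Lo_def omit_entry_omit_entry)
    then show "f (Suc j, i) = - f (i, j)"
      by (simp add: f_def add.commute)
  qed
  finally have cancel: "sum f Lo + sum f Up = 0"
    by (simp add: sum_negf)
  have "AS_coboundary Z (Suc q) (AS_coboundary Z q \<xi>) t =
      (\<Sum>i\<le>Suc (Suc q). \<Sum>j\<le>Suc q. f (i, j))"
    using t omit_entry_in_PiE[OF t]
    by (simp add: AS_coboundary_def topspace_tuple_space f_def sum_distrib_left power_add mult.assoc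
             del: sum.atMost_Suc)
  also have "\<dots> = sum f ({..Suc (Suc q)} \<times> {..Suc q})"
    by (simp only: sum.cartesian_product case_prod_eta)
  also have "\<dots> = sum f Lo + sum f Up"
    unfolding un by (rule sum.union_disjoint[OF fin disj])
  finally show ?thesis using cancel by simp
qed

locale pointed_space =
  fixes Z :: "'z topology" and a :: 'z
  assumes basepoint: "a \<in> topspace Z"
begin

abbreviation C :: "nat \<Rightarrow> ((nat \<Rightarrow> 'z) \<Rightarrow> 'r::{comm_ring,monoid_mult}) monoid"
  where "C q \<equiv> AS_cochain_group Z a q"

abbreviation L :: "nat \<Rightarrow> ((nat \<Rightarrow> 'z) \<Rightarrow> 'r::{comm_ring,monoid_mult}) set"
  where "L q \<equiv> locally_zero_cochains Z a q"

abbreviation \<delta> :: "nat \<Rightarrow> ((nat \<Rightarrow> 'z) \<Rightarrow> 'r::{comm_ring,monoid_mult}) \<Rightarrow> (nat \<Rightarrow> 'z) \<Rightarrow> 'r"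
  where "\<delta> q \<equiv> AS_coboundary Z q"

lemma cochain_iff:
  "\<xi> \<in> carrier (C q) \<longleftrightarrow> \<xi> \<in> extensional ({..q} \<rightarrow>\<^sub>E topspace Z) \<and> \<xi> (const_tuple q a) = 0"
  by (simp add: AS_cochain_group_def topspace_tuple_space)

lemma cochain_eqI:
  assumes "\<xi> \<in> carrier (C q)" "\<eta> \<in> carrier (C q)"
    and "\<And>t. t \<in> {..q} \<rightarrow>\<^sub>E topspace Z \<Longrightarrow> \<xi> t = \<eta> t"
  shows "\<xi> = \<eta>"
  using assms by (auto simp: cochain_iff intro: extensionalityI)

lemma mult_cochain_apply:
  "t \<in> {..q} \<rightarrow>\<^sub>E topspace Z \<Longrightarrow> (\<xi> \<otimes>\<^bsub>C q\<^esub> \<eta>) t = \<xi> t + \<eta> t"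
  by (simp add: AS_cochain_group_def topspace_tuple_space)

lemma one_cochain_apply: "t \<in> {..q} \<rightarrow>\<^sub>E topspace Z \<Longrightarrow> \<one>\<^bsub>C q\<^esub> t = 0"
  by (simp add: AS_cochain_group_def topspace_tuple_space)

lemma vanishes_near_mult:
  assumes "vanishes_near Z q z \<xi>" "vanishes_near Z q z \<eta>"
  shows "vanishes_near Z q z (\<xi> \<otimes>\<^bsub>C q\<^esub> \<eta>)"
  by (rule vanishes_near_combine[OF assms]) (simp add: mult_cochain_apply)

lemma comm_group_cochains:
  "comm_group (C q :: ((nat \<Rightarrow> 'z) \<Rightarrow> 'r::{comm_ring,monoid_mult}) monoid)"
proof (rule comm_groupI)
  note const = const_tuple_in_PiE[OF basepoint, of q]
  fix \<xi> \<eta> :: "(nat \<Rightarrow> 'z) \<Rightarrow> 'r"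
  assume \<xi>: "\<xi> \<in> carrier (C q)" and \<eta>: "\<eta> \<in> carrier (C q)"
  show mult: "\<xi> \<otimes>\<^bsub>C q\<^esub> \<eta> \<in> carrier (C q)"
    using \<xi> \<eta> const by (simp add: AS_cochain_group_def topspace_tuple_space)
  show "\<xi> \<otimes>\<^bsub>C q\<^esub> \<eta> = \<eta> \<otimes>\<^bsub>C q\<^esub> \<xi>"
    by (simp add: AS_cochain_group_def add.commute)
  show "\<one>\<^bsub>C q\<^esub> \<otimes>\<^bsub>C q\<^esub> \<xi> = \<xi>"
    using \<xi> by (auto simp: AS_cochain_group_def extensional_def fun_eq_iff)
  show "\<exists>\<zeta>\<in>carrier (C q). \<zeta> \<otimes>\<^bsub>C q\<^esub> \<xi> = \<one>\<^bsub>C q\<^esub>"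
  proof
    show "(\<lambda>t\<in>topspace (tuple_space Z q). - \<xi> t) \<in> carrier (C q)"
      using \<xi> const by (simp add: cochain_iff topspace_tuple_space)
    show "(\<lambda>t\<in>topspace (tuple_space Z q). - \<xi> t) \<otimes>\<^bsub>C q\<^esub> \<xi> = \<one>\<^bsub>C q\<^esub>"
      by (auto simp: AS_cochain_group_def fun_eq_iff)
  qed
next
  show "\<one>\<^bsub>C q\<^esub> \<in> carrier (C q)"
    using const_tuple_in_PiE[OF basepoint, of q]
    by (simp add: AS_cochain_group_def topspace_tuple_space)
qed (auto simp: AS_cochain_group_def fun_eq_iff add.assoc)

lemma inv_cochain_apply:
  fixes \<xi> :: "(nat \<Rightarrow> 'z) \<Rightarrow> 'r::{comm_ring,monoid_mult}"
  assumes \<xi>: "\<xi> \<in> carrier (C q)" and t: "t \<in> {..q} \<rightarrow>\<^sub>E topspace Z"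
  shows "(inv\<^bsub>C q\<^esub> \<xi>) t = - \<xi> t"
proof -
  interpret comm_group "C q :: ((nat \<Rightarrow> 'z) \<Rightarrow> 'r) monoid" by (rule comm_group_cochains)
  have "(inv\<^bsub>C q\<^esub> \<xi> \<otimes>\<^bsub>C q\<^esub> \<xi>) t = 0"
    using \<xi> t by (simp add: one_cochain_apply)
  then show ?thesis
    using t by (simp add: mult_cochain_apply eq_neg_iff_add_eq_0)
qed

text \<open>
  Checking local vanishing point by point replaces constructions of open sets in the power of \<open>Z\<close>
  by constructions of open sets in \<open>Z\<close>.
\<close>

lemma locally_zero_iff:
  "\<xi> \<in> L q \<longleftrightarrow> \<xi> \<in> carrier (C q) \<and> (\<forall>z \<in> topspace Z. vanishes_near Z q z \<xi>)"
  by (simp only: vanishes_near_all_iff locally_zero_cochains_def mem_Collect_eq)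

lemma subgroup_locally_zero:
  "subgroup (L q) (C q :: ((nat \<Rightarrow> 'z) \<Rightarrow> 'r::{comm_ring,monoid_mult}) monoid)"
proof -
  interpret comm_group "C q :: ((nat \<Rightarrow> 'z) \<Rightarrow> 'r) monoid" by (rule comm_group_cochains)
  show ?thesis
  proof (rule subgroupI)
    show "L q \<subseteq> carrier (C q :: ((nat \<Rightarrow> 'z) \<Rightarrow> 'r) monoid)"
      by (auto simp: locally_zero_iff)
    have "vanishes_near Z q z (\<one>\<^bsub>C q\<^esub> :: (nat \<Rightarrow> 'z) \<Rightarrow> 'r)" if "z \<in> topspace Z" for z
      unfolding vanishes_near_def
      by (rule exI[of _ "topspace Z"]) (simp add: that one_cochain_apply)
    then have "(\<one>\<^bsub>C q\<^esub> :: (nat \<Rightarrow> 'z) \<Rightarrow> 'r) \<in> L q"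
      by (simp add: locally_zero_iff)
    then show "L q \<noteq> ({} :: ((nat \<Rightarrow> 'z) \<Rightarrow> 'r) set)"
      by blast
  next
    fix \<xi> \<eta> :: "(nat \<Rightarrow> 'z) \<Rightarrow> 'r"
    assume \<xi>: "\<xi> \<in> L q" and \<eta>: "\<eta> \<in> L q"
    show "\<xi> \<otimes>\<^bsub>C q\<^esub> \<eta> \<in> L q"
      unfolding locally_zero_iff
    proof (intro conjI ballI)
      show "\<xi> \<otimes>\<^bsub>C q\<^esub> \<eta> \<in> carrier (C q)"
        by (rule m_closed) (use \<xi> \<eta> in \<open>simp_all add: locally_zero_iff\<close>)
    next
      fix z assume z: "z \<in> topspace Z"
      show "vanishes_near Z q z (\<xi> \<otimes>\<^bsub>C q\<^esub> \<eta>)"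
        using \<xi> \<eta> z by (intro vanishes_near_mult) (auto simp: locally_zero_iff)
    qed
  next
    fix \<xi> :: "(nat \<Rightarrow> 'z) \<Rightarrow> 'r"
    assume \<xi>: "\<xi> \<in> L q"
    show "inv\<^bsub>C q\<^esub> \<xi> \<in> L q"
      unfolding locally_zero_iff
    proof (intro conjI ballI)
      show "inv\<^bsub>C q\<^esub> \<xi> \<in> carrier (C q)"
        by (rule inv_closed) (use \<xi> in \<open>simp add: locally_zero_iff\<close>)
    next
      fix z assume z: "z \<in> topspace Z"
      have "vanishes_near Z q z \<xi>"
        using \<xi> z by (auto simp: locally_zero_iff)
      then show "vanishes_near Z q z (inv\<^bsub>C q\<^esub> \<xi>)"
        using \<open>vanishes_near Z q z \<xi>\<close>
        by (rule vanishes_near_combine) (use \<xi> in \<open>simp add: inv_cochain_apply locally_zero_iff\<close>)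
    qed
  qed
qed

lemma normal_locally_zero:
  "L q \<lhd> (C q :: ((nat \<Rightarrow> 'z) \<Rightarrow> 'r::{comm_ring,monoid_mult}) monoid)"
  by (simp add: comm_group.normal_iff_subgroup[OF comm_group_cochains] subgroup_locally_zero)

lemma coboundary_closed:
  fixes \<xi> :: "(nat \<Rightarrow> 'z) \<Rightarrow> 'r::{comm_ring,monoid_mult}"
  assumes "\<xi> \<in> carrier (C q)"
  shows "\<delta> q \<xi> \<in> carrier (C (Suc q))"
  using assms const_tuple_in_PiE[OF basepoint, of "Suc q"]
  by (simp add: cochain_iff AS_coboundary_def topspace_tuple_space omit_entry_const_tuple)

lemma coboundary_mult:
  fixes \<xi> \<eta> :: "(nat \<Rightarrow> 'z) \<Rightarrow> 'r::{comm_ring,monoid_mult}"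
  shows "\<delta> q (\<xi> \<otimes>\<^bsub>C q\<^esub> \<eta>) = \<delta> q \<xi> \<otimes>\<^bsub>C (Suc q)\<^esub> \<delta> q \<eta>"
proof
  fix t
  show "\<delta> q (\<xi> \<otimes>\<^bsub>C q\<^esub> \<eta>) t = (\<delta> q \<xi> \<otimes>\<^bsub>C (Suc q)\<^esub> \<delta> q \<eta>) t"
  proof (cases "t \<in> {..Suc q} \<rightarrow>\<^sub>E topspace Z")
    case True
    then show ?thesis
      using omit_entry_in_PiE[OF True]
      by (simp add: mult_cochain_apply AS_coboundary_def topspace_tuple_space distrib_left
            sum.distrib del: sum.atMost_Suc)
  qed (simp add: AS_coboundary_def AS_cochain_group_def topspace_tuple_space)
qed

lemma group_hom_coboundary:
  "group_hom (C q :: ((nat \<Rightarrow> 'z) \<Rightarrow> 'r::{comm_ring,monoid_mult}) monoid) (C (Suc q)) (\<delta> q)"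
  by (intro group_hom.intro group_hom_axioms.intro comm_group.axioms(2) comm_group_cochains homI)
    (simp_all add: coboundary_closed coboundary_mult)

lemma coboundary_locally_zero:
  "\<xi> \<in> L q \<Longrightarrow> \<delta> q \<xi> \<in> L (Suc q)"
  by (auto simp: locally_zero_iff coboundary_closed vanishes_near_coboundary)

lemma coboundary_coboundary_eq_one:
  fixes \<xi> :: "(nat \<Rightarrow> 'z) \<Rightarrow> 'r::{comm_ring,monoid_mult}"
  assumes "\<xi> \<in> carrier (C q)"
  shows "\<delta> (Suc q) (\<delta> q \<xi>) = \<one>\<^bsub>C (Suc (Suc q))\<^esub>"
proof -
  interpret comm_group "C (Suc (Suc q)) :: ((nat \<Rightarrow> 'z) \<Rightarrow> 'r) monoid"
    by (rule comm_group_cochains)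
  show ?thesis
    by (rule cochain_eqI)
      (use assms in \<open>auto simp: coboundary_closed coboundary_coboundary one_cochain_apply\<close>)
qed

section \<open>Cohomology classes of cochains\<close>

abbreviation Q :: "nat \<Rightarrow> ((nat \<Rightarrow> 'z) \<Rightarrow> 'r::{comm_ring,monoid_mult}) set monoid"
  where "Q q \<equiv> AS_quotient_group Z a q"

abbreviation K :: "nat \<Rightarrow> ((nat \<Rightarrow> 'z) \<Rightarrow> 'r::{comm_ring,monoid_mult}) set monoid"
  where "K q \<equiv> AS_cocycle_group Z a q"

text \<open>
  In degree 0 only the zero cochain is exact, because there are no cochains of degree \<open>-1\<close>. Making
  this a single family lets the degrees be treated alike in the comparison of classes.
\<close>

definition exact_cochains :: "nat \<Rightarrow> ((nat \<Rightarrow> 'z) \<Rightarrow> 'r::{comm_ring,monoid_mult}) set"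
  where "exact_cochains q = (case q of 0 \<Rightarrow> {\<one>\<^bsub>C 0\<^esub>} | Suc p \<Rightarrow> \<delta> p ` carrier (C p))"

definition cocycles_mod_locally_zero :: "nat \<Rightarrow> ((nat \<Rightarrow> 'z) \<Rightarrow> 'r::{comm_ring,monoid_mult}) set"
  where "cocycles_mod_locally_zero q = {\<xi> \<in> carrier (C q). \<delta> q \<xi> \<in> L (Suc q)}"

lemma comm_group_quotient: "comm_group (Q q :: ((nat \<Rightarrow> 'z) \<Rightarrow> 'r::{comm_ring,monoid_mult}) set monoid)"
  unfolding AS_quotient_group_def
  by (rule comm_group.abelian_FactGroup[OF comm_group_cochains subgroup_locally_zero])

lemma carrier_quotient: "carrier (Q q) = (\<lambda>\<xi>. L q #>\<^bsub>C q\<^esub> \<xi>) ` carrier (C q)"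
  by (simp add: AS_quotient_group_def carrier_FactGroup)

lemma mult_quotient:
  assumes "\<xi> \<in> carrier (C q)" "\<eta> \<in> carrier (C q)"
  shows "(L q #>\<^bsub>C q\<^esub> \<xi>) \<otimes>\<^bsub>Q q\<^esub> (L q #>\<^bsub>C q\<^esub> \<eta>) = L q #>\<^bsub>C q\<^esub> (\<xi> \<otimes>\<^bsub>C q\<^esub> \<eta>)"
  by (simp add: AS_quotient_group_def normal.rcos_sum[OF normal_locally_zero assms])

lemma one_quotient: "\<one>\<^bsub>Q q\<^esub> = L q"
  by (simp add: AS_quotient_group_def)

lemma coset_eq_locally_zero_iff:
  assumes \<xi>: "\<xi> \<in> carrier (C q)"
  shows "L q #>\<^bsub>C q\<^esub> \<xi> = L q \<longleftrightarrow> \<xi> \<in> L q"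
proof -
  interpret comm_group "C q" by (rule comm_group_cochains)
  show ?thesis
    using \<xi> coset_join1[OF _ \<xi> subgroup_locally_zero] coset_join2[OF \<xi> subgroup_locally_zero] by blast
qed

text \<open>
  The union that defines the coboundary of a coset collapses to one coset, since the coboundary
  preserves locally zero cochains.
\<close>

lemma quotient_coboundary_coset:
  fixes \<xi> :: "(nat \<Rightarrow> 'z) \<Rightarrow> 'r::{comm_ring,monoid_mult}"
  assumes \<xi>: "\<xi> \<in> carrier (C q)"
  shows "AS_quotient_coboundary Z a q (L q #>\<^bsub>C q\<^esub> \<xi>) = L (Suc q) #>\<^bsub>C (Suc q)\<^esub> \<delta> q \<xi>"
proof -
  interpret comm_group "C (Suc q) :: ((nat \<Rightarrow> 'z) \<Rightarrow> 'r) monoid" by (rule comm_group_cochains)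
  have "L (Suc q) #>\<^bsub>C (Suc q)\<^esub> \<delta> q \<eta> = L (Suc q) #>\<^bsub>C (Suc q)\<^esub> \<delta> q \<xi>"
    if \<eta>: "\<eta> \<in> L q #>\<^bsub>C q\<^esub> \<xi>" for \<eta>
  proof -
    obtain \<nu> where "\<nu> \<in> L q" and \<eta>_eq: "\<eta> = \<nu> \<otimes>\<^bsub>C q\<^esub> \<xi>"
      using \<eta> by (auto simp: r_coset_def)
    then have "\<delta> q \<eta> \<in> L (Suc q) #>\<^bsub>C (Suc q)\<^esub> \<delta> q \<xi>"
      using coboundary_locally_zero[of \<nu> q] by (auto simp: r_coset_def coboundary_mult)
    then show ?thesis
      using repr_independence[OF _ coboundary_closed[OF \<xi>] subgroup_locally_zero] by simp
  qed
  moreover have "\<xi> \<in> L q #>\<^bsub>C q\<^esub> \<xi>"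
    using group.rcos_self[OF comm_group.axioms(2)[OF comm_group_cochains] \<xi> subgroup_locally_zero] .
  ultimately show ?thesis
    unfolding AS_quotient_coboundary_def by blast
qed

lemma group_hom_quotient_coboundary:
  "group_hom (Q q :: ((nat \<Rightarrow> 'z) \<Rightarrow> 'r::{comm_ring,monoid_mult}) set monoid) (Q (Suc q))
     (AS_quotient_coboundary Z a q)"
proof (intro group_hom.intro group_hom_axioms.intro comm_group.axioms(2) comm_group_quotient homI)
  fix X :: "((nat \<Rightarrow> 'z) \<Rightarrow> 'r) set" assume "X \<in> carrier (Q q)"
  then show "AS_quotient_coboundary Z a q X \<in> carrier (Q (Suc q))"
    by (auto simp: carrier_quotient quotient_coboundary_coset coboundary_closed)
next
  fix X Y :: "((nat \<Rightarrow> 'z) \<Rightarrow> 'r) set" assume X: "X \<in> carrier (Q q)" and Y: "Y \<in> carrier (Q q)"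
  interpret comm_group "C q :: ((nat \<Rightarrow> 'z) \<Rightarrow> 'r) monoid" by (rule comm_group_cochains)
  show "AS_quotient_coboundary Z a q (X \<otimes>\<^bsub>Q q\<^esub> Y) =
      AS_quotient_coboundary Z a q X \<otimes>\<^bsub>Q (Suc q)\<^esub> AS_quotient_coboundary Z a q Y"
    using X Y by (auto simp: carrier_quotient quotient_coboundary_coset coboundary_closed
        mult_quotient coboundary_mult)
qed

lemma carrier_cocycle_group:
  "carrier (K q :: ((nat \<Rightarrow> 'z) \<Rightarrow> 'r::{comm_ring,monoid_mult}) set monoid) = (\<lambda>\<xi>. L q #>\<^bsub>C q\<^esub> \<xi>) ` cocycles_mod_locally_zero q"
proof -
  have "AS_quotient_coboundary Z a q (L q #>\<^bsub>C q\<^esub> \<xi>) = L (Suc q) \<longleftrightarrow> \<delta> q \<xi> \<in> L (Suc q)"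
    if "\<xi> \<in> carrier (C q)" for \<xi> :: "(nat \<Rightarrow> 'z) \<Rightarrow> 'r"
    using that by (simp add: quotient_coboundary_coset coset_eq_locally_zero_iff coboundary_closed)
  then show ?thesis
    unfolding AS_cocycle_group_def kernel_def carrier_quotient one_quotient cocycles_mod_locally_zero_def
    by (simp add: image_def) blast
qed

lemma mult_cocycle_group: "(\<otimes>\<^bsub>K q\<^esub>) = (\<otimes>\<^bsub>Q q\<^esub>)"
  by (simp add: AS_cocycle_group_def)

lemma subgroup_cocycles_quotient:
  "subgroup (carrier (K q)) (Q q :: ((nat \<Rightarrow> 'z) \<Rightarrow> 'r::{comm_ring,monoid_mult}) set monoid)"
  using group_hom.subgroup_kernel[OF group_hom_quotient_coboundary] by (simp add: AS_cocycle_group_def)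

lemma comm_group_cocycles: "comm_group (K q :: ((nat \<Rightarrow> 'z) \<Rightarrow> 'r::{comm_ring,monoid_mult}) set monoid)"
proof (rule group.group_comm_groupI)
  interpret Q: comm_group "Q q :: ((nat \<Rightarrow> 'z) \<Rightarrow> 'r) set monoid" by (rule comm_group_quotient)
  show "group (K q :: ((nat \<Rightarrow> 'z) \<Rightarrow> 'r) set monoid)"
    using subgroup.subgroup_is_group[OF subgroup_cocycles_quotient Q.is_group]
    by (simp add: AS_cocycle_group_def)
  fix X Y :: "((nat \<Rightarrow> 'z) \<Rightarrow> 'r) set"
  assume "X \<in> carrier (K q)" "Y \<in> carrier (K q)"
  then have "X \<in> carrier (Q q)" "Y \<in> carrier (Q q)"
    by (auto intro: subsetD[OF subgroup.subset[OF subgroup_cocycles_quotient]])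
  then show "X \<otimes>\<^bsub>K q\<^esub> Y = Y \<otimes>\<^bsub>K q\<^esub> X"
    unfolding mult_cocycle_group by (rule Q.m_comm)
qed

lemma exact_cochains_0: "exact_cochains 0 = {\<one>\<^bsub>C 0\<^esub>}"
  and exact_cochains_Suc: "exact_cochains (Suc p) = \<delta> p ` carrier (C p)"
  by (simp_all add: exact_cochains_def)

lemma one_cochain_closed: "\<one>\<^bsub>C q\<^esub> \<in> carrier (C q)"
  using monoid.one_closed[OF comm_monoid.axioms(1)[OF comm_group.axioms(1)[OF comm_group_cochains]]] .

lemma one_locally_zero: "\<one>\<^bsub>C q\<^esub> \<in> L q"
  by (rule subgroup.one_closed[OF subgroup_locally_zero])

lemma exact_cochain_closed: "\<beta> \<in> exact_cochains q \<Longrightarrow> \<beta> \<in> carrier (C q)"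
  by (cases q) (auto simp: exact_cochains_0 exact_cochains_Suc one_cochain_closed coboundary_closed)

lemma coboundary_exact_cochain: "\<beta> \<in> exact_cochains q \<Longrightarrow> \<delta> q \<beta> = \<one>\<^bsub>C (Suc q)\<^esub>"
proof (cases q)
  case 0
  assume "\<beta> \<in> exact_cochains q"
  then have \<beta>: "\<beta> = \<one>\<^bsub>C 0\<^esub>" using 0 by (simp add: exact_cochains_0)
  show ?thesis
    unfolding \<beta> 0 by (rule group_hom.hom_one[OF group_hom_coboundary])
qed (auto simp: exact_cochains_Suc coboundary_coboundary_eq_one)

lemma exact_imp_cocycle: "\<beta> \<in> exact_cochains q \<Longrightarrow> \<beta> \<in> cocycles_mod_locally_zero q"
  by (simp add: cocycles_mod_locally_zero_def exact_cochain_closed coboundary_exact_cochain one_locally_zero)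

lemma coboundaries_eq: "AS_coboundaries Z a q = (\<lambda>\<beta>. L q #>\<^bsub>C q\<^esub> \<beta>) ` exact_cochains q"
proof (cases q)
  case 0
  then show ?thesis
    by (simp add: AS_coboundaries_def exact_cochains_0 one_quotient
        coset_eq_locally_zero_iff[OF one_cochain_closed, THEN iffD2, OF one_locally_zero])
next
  case (Suc p)
  then show ?thesis
    by (auto simp: AS_coboundaries_def exact_cochains_Suc carrier_quotient quotient_coboundary_coset image_image)
qed

lemma subgroup_coboundaries:
  "subgroup (AS_coboundaries Z a q) (K q :: ((nat \<Rightarrow> 'z) \<Rightarrow> 'r::{comm_ring,monoid_mult}) set monoid)"
proof -
  interpret comm_group "Q q :: ((nat \<Rightarrow> 'z) \<Rightarrow> 'r) set monoid" by (rule comm_group_quotient)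
  have "subgroup (AS_coboundaries Z a q) (Q q :: ((nat \<Rightarrow> 'z) \<Rightarrow> 'r) set monoid)"
  proof (cases q)
    case 0
    have "AS_coboundaries Z a q = {\<one>\<^bsub>Q q\<^esub> :: ((nat \<Rightarrow> 'z) \<Rightarrow> 'r) set}"
      by (simp add: 0 AS_coboundaries_def)
    then show ?thesis
      using triv_subgroup by simp
  next
    case (Suc p)
    show ?thesis
      unfolding Suc AS_coboundaries_def nat.case
      by (rule group_hom.img_is_subgroup[OF group_hom_quotient_coboundary])
  qed
  moreover have "AS_coboundaries Z a q \<subseteq> carrier (K q :: ((nat \<Rightarrow> 'z) \<Rightarrow> 'r) set monoid)"
    unfolding coboundaries_eq carrier_cocycle_group using exact_imp_cocycle by blast
  ultimately have "subgroup (AS_coboundaries Z a q) (Q q \<lparr>carrier := carrier (K q :: ((nat \<Rightarrow> 'z) \<Rightarrow> 'r) set monoid)\<rparr>)"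
    using subgroup_cocycles_quotient subgroup_incl by blast
  then show ?thesis
    by (simp add: AS_cocycle_group_def)
qed

lemma normal_coboundaries:
  "AS_coboundaries Z a q \<lhd> (K q :: ((nat \<Rightarrow> 'z) \<Rightarrow> 'r::{comm_ring,monoid_mult}) set monoid)"
  by (simp add: comm_group.normal_iff_subgroup[OF comm_group_cocycles] subgroup_coboundaries)

lemma coset_in_cocycle_group:
  "\<xi> \<in> cocycles_mod_locally_zero q \<Longrightarrow> L q #>\<^bsub>C q\<^esub> \<xi> \<in> carrier (K q)"
  by (simp add: carrier_cocycle_group)

lemma carrier_cohomology:
  "carrier (AS_cohomology Z a q) = AS_class Z a q ` cocycles_mod_locally_zero q"
  by (auto simp: AS_cohomology_def carrier_FactGroup carrier_cocycle_group AS_class_def)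

lemma mult_class:
  assumes \<xi>: "\<xi> \<in> cocycles_mod_locally_zero q" and \<eta>: "\<eta> \<in> cocycles_mod_locally_zero q"
  shows "AS_class Z a q \<xi> \<otimes>\<^bsub>AS_cohomology Z a q\<^esub> AS_class Z a q \<eta> =
    AS_class Z a q (\<xi> \<otimes>\<^bsub>C q\<^esub> \<eta>)"
  using \<xi> \<eta> normal.rcos_sum[OF normal_coboundaries coset_in_cocycle_group[OF \<xi>] coset_in_cocycle_group[OF \<eta>]]
  by (simp add: AS_cohomology_def AS_class_def mult_cocycle_group mult_quotient cocycles_mod_locally_zero_def)

text \<open>
  Cohomology is a quotient of a quotient: first locally zero cochains are divided out, then cosets
  of exact cochains. Undoing both steps turns an equality of classes into an equation between
  cochains, which is what the series can be applied to.
\<close>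

lemma class_eq_iff:
  fixes \<xi> \<eta> :: "(nat \<Rightarrow> 'z) \<Rightarrow> 'r::{comm_ring,monoid_mult}"
  assumes \<xi>: "\<xi> \<in> cocycles_mod_locally_zero q" and \<eta>: "\<eta> \<in> cocycles_mod_locally_zero q"
  shows "AS_class Z a q \<xi> = AS_class Z a q \<eta> \<longleftrightarrow>
    (\<exists>\<nu>\<in>L q. \<exists>\<beta>\<in>exact_cochains q. \<xi> = \<nu> \<otimes>\<^bsub>C q\<^esub> (\<beta> \<otimes>\<^bsub>C q\<^esub> \<eta>))"
proof -
  interpret C: comm_group "C q :: ((nat \<Rightarrow> 'z) \<Rightarrow> 'r) monoid" by (rule comm_group_cochains)
  interpret K: comm_group "K q :: ((nat \<Rightarrow> 'z) \<Rightarrow> 'r) set monoid" by (rule comm_group_cocycles)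
  have \<xi>C: "\<xi> \<in> carrier (C q)" and \<eta>C: "\<eta> \<in> carrier (C q)"
    using \<xi> \<eta> by (auto simp: cocycles_mod_locally_zero_def)
  let ?X = "L q #>\<^bsub>C q\<^esub> \<xi>" and ?Y = "L q #>\<^bsub>C q\<^esub> \<eta>"
  have "AS_class Z a q \<xi> = AS_class Z a q \<eta> \<longleftrightarrow> ?X \<in> AS_coboundaries Z a q #>\<^bsub>K q\<^esub> ?Y"
    unfolding AS_class_def
    using K.repr_independenceD[OF subgroup_coboundaries coset_in_cocycle_group[OF \<xi>]]
      K.repr_independence[OF _ coset_in_cocycle_group[OF \<eta>] subgroup_coboundaries] by metis
  also have "\<dots> \<longleftrightarrow> (\<exists>\<beta>\<in>exact_cochains q. ?X = L q #>\<^bsub>C q\<^esub> (\<beta> \<otimes>\<^bsub>C q\<^esub> \<eta>))"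
    using \<eta>C by (auto simp: r_coset_def[of "K q"] coboundaries_eq mult_cocycle_group mult_quotient exact_cochain_closed)
  also have "\<dots> \<longleftrightarrow> (\<exists>\<beta>\<in>exact_cochains q. \<xi> \<in> L q #>\<^bsub>C q\<^esub> (\<beta> \<otimes>\<^bsub>C q\<^esub> \<eta>))"
  proof (rule bex_cong[OF refl])
    fix \<beta> :: "(nat \<Rightarrow> 'z) \<Rightarrow> 'r" assume "\<beta> \<in> exact_cochains q"
    then have "\<beta> \<otimes>\<^bsub>C q\<^esub> \<eta> \<in> carrier (C q)"
      using \<eta>C by (simp add: exact_cochain_closed)
    then show "?X = L q #>\<^bsub>C q\<^esub> (\<beta> \<otimes>\<^bsub>C q\<^esub> \<eta>) \<longleftrightarrow> \<xi> \<in> L q #>\<^bsub>C q\<^esub> (\<beta> \<otimes>\<^bsub>C q\<^esub> \<eta>)"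
      using C.repr_independenceD[OF subgroup_locally_zero \<xi>C]
        C.repr_independence[OF _ _ subgroup_locally_zero] by metis
  qed
  finally show ?thesis
    by (auto simp: r_coset_def)
qed

section \<open>Contracting cocycles near the base point\<close>

text \<open>
  The cone with apex \<open>a\<close>. Its entries stay in any set that contains \<open>a\<close> and the entries of \<open>t\<close>, so
  it contracts the complex of cochains on any neighbourhood of \<open>a\<close>.
\<close>

definition cone_tuple :: "nat \<Rightarrow> (nat \<Rightarrow> 'z) \<Rightarrow> nat \<Rightarrow> 'z" where
  "cone_tuple q t = (\<lambda>i\<in>{..Suc q}. case i of 0 \<Rightarrow> a | Suc k \<Rightarrow> t k)"

lemma cone_tuple_in_PiE: "a \<in> U \<Longrightarrow> t \<in> {..q} \<rightarrow>\<^sub>E U \<Longrightarrow> cone_tuple q t \<in> {..Suc q} \<rightarrow>\<^sub>E U"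
  unfolding cone_tuple_def by (rule restrict_PiE_iff[THEN iffD2]) (auto split: nat.split)

lemma omit_entry_0_cone_tuple:
  assumes "t \<in> {..q} \<rightarrow>\<^sub>E U" shows "omit_entry q 0 (cone_tuple q t) = t"
proof (rule extensionalityI[of _ "{..q}"])
  show "t \<in> extensional {..q}" using assms by (simp add: PiE_iff)
qed (auto simp: omit_entry_def cone_tuple_def)

lemma omit_entry_Suc_cone_tuple:
  "omit_entry (Suc q) (Suc j) (cone_tuple (Suc q) t) = cone_tuple q (omit_entry q j t)"
  by (rule ext) (simp add: omit_entry_def cone_tuple_def split: nat.split)

lemma cone_const_tuple: "cone_tuple q (const_tuple q a) = const_tuple (Suc q) a"
  by (rule ext) (simp add: const_tuple_def cone_tuple_def split: nat.split)

text \<open>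
  The face opposite the apex is the tuple itself. Separating this term is what lets the cone
  recover \<open>\<xi>\<close> from its coboundary.
\<close>

lemma coboundary_cone_tuple:
  fixes \<xi> :: "(nat \<Rightarrow> 'z) \<Rightarrow> 'r::{comm_ring,monoid_mult}"
  assumes t: "t \<in> {..q} \<rightarrow>\<^sub>E topspace Z"
  shows "\<delta> q \<xi> (cone_tuple q t) =
    \<xi> t - (\<Sum>j\<le>q. (- 1) ^ j * \<xi> (omit_entry q (Suc j) (cone_tuple q t)))"
  using cone_tuple_in_PiE[OF basepoint t] omit_entry_0_cone_tuple[OF t]
  by (simp add: AS_coboundary_def topspace_tuple_space sum.atMost_Suc_shift sum_negf del: sum.atMost_Suc)

text \<open>
  For tuples near \<open>a\<close> the coboundary on the cone vanishes, and the cone formula says that \<open>\<xi>\<close>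
  agrees there with the coboundary of \<open>t \<mapsto> \<xi> (cone_tuple p t)\<close>. That cochain is defined on all
  tuples of \<open>Z\<close>, so an exact cochain can be subtracted globally to make \<open>\<xi>\<close> vanish near \<open>a\<close>. In degree 0
  the cone formula compares \<open>\<xi>\<close> with its value at \<open>a\<close>, which is zero.
\<close>

lemma cocycle_near_basepoint_is_exact:
  fixes \<xi> :: "(nat \<Rightarrow> 'z) \<Rightarrow> 'r::{comm_ring,monoid_mult}"
  assumes \<xi>: "\<xi> \<in> carrier (C q)" and near: "vanishes_near Z (Suc q) a (\<delta> q \<xi>)"
  shows "\<exists>\<beta>\<in>exact_cochains q. vanishes_near Z q a (\<xi> \<otimes>\<^bsub>C q\<^esub> inv\<^bsub>C q\<^esub> \<beta>)"
proof -
  obtain U where U: "openin Z U" "a \<in> U" "\<And>t. t \<in> {..Suc q} \<rightarrow>\<^sub>E U \<Longrightarrow> \<delta> q \<xi> t = 0"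
    using near by (auto simp: vanishes_near_def)
  have UZ: "t \<in> {..q} \<rightarrow>\<^sub>E topspace Z" if "t \<in> {..q} \<rightarrow>\<^sub>E U" for t
    using that openin_subset[OF U(1)] PiE_mono[of "{..q}" "\<lambda>_. U" "\<lambda>_. topspace Z"] by blast
  have cone: "\<xi> t = (\<Sum>j\<le>q. (- 1) ^ j * \<xi> (omit_entry q (Suc j) (cone_tuple q t)))"
    if t: "t \<in> {..q} \<rightarrow>\<^sub>E U" for t
    using coboundary_cone_tuple[OF UZ[OF t], of \<xi>] U(3)[OF cone_tuple_in_PiE[OF U(2) t]] by simp
  have "\<exists>\<beta>\<in>exact_cochains q. \<forall>t \<in> {..q} \<rightarrow>\<^sub>E U. \<xi> t = \<beta> t"
  proof (cases q)
    case 0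
    have "\<xi> t = \<one>\<^bsub>C q\<^esub> t" if t: "t \<in> {..q} \<rightarrow>\<^sub>E U" for t
    proof -
      have "omit_entry q (Suc 0) (cone_tuple q t) = const_tuple q a"
        by (auto simp: 0 omit_entry_def cone_tuple_def const_tuple_def)
      then have "\<xi> t = \<xi> (const_tuple q a)"
        using cone[OF t] by (simp add: 0)
      then show ?thesis
        using \<xi> UZ[OF t] by (simp add: cochain_iff one_cochain_apply)
    qed
    then show ?thesis
      by (simp add: 0 exact_cochains_0)
  next
    case (Suc p)
    define \<eta> where "\<eta> = (\<lambda>t\<in>topspace (tuple_space Z p). \<xi> (cone_tuple p t))"
    have "\<eta> \<in> carrier (C p)"
      using \<xi> const_tuple_in_PiE[OF basepoint, of p]
      by (simp add: \<eta>_def cochain_iff topspace_tuple_space cone_const_tuple Suc)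
    moreover have "\<xi> t = \<delta> p \<eta> t" if t: "t \<in> {..q} \<rightarrow>\<^sub>E U" for t
    proof -
      have tZ: "t \<in> {..Suc p} \<rightarrow>\<^sub>E topspace Z"
        using UZ[OF t] by (simp add: Suc)
      show ?thesis
        using cone[OF t] tZ omit_entry_in_PiE[OF tZ]
        by (simp add: Suc omit_entry_Suc_cone_tuple AS_coboundary_def topspace_tuple_space \<eta>_def
            del: sum.atMost_Suc)
    qed
    ultimately show ?thesis
      by (auto simp: Suc exact_cochains_Suc)
  qed
  then obtain \<beta> where \<beta>: "\<beta> \<in> exact_cochains q" "\<And>t. t \<in> {..q} \<rightarrow>\<^sub>E U \<Longrightarrow> \<xi> t = \<beta> t"
    by blast
  have "(\<xi> \<otimes>\<^bsub>C q\<^esub> inv\<^bsub>C q\<^esub> \<beta>) t = 0" if t: "t \<in> {..q} \<rightarrow>\<^sub>E U" for t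
    using UZ[OF t] \<beta>(2)[OF t] exact_cochain_closed[OF \<beta>(1)]
    by (simp add: mult_cochain_apply inv_cochain_apply)
  then have "vanishes_near Z q a (\<xi> \<otimes>\<^bsub>C q\<^esub> inv\<^bsub>C q\<^esub> \<beta>)"
    using U(1,2) unfolding vanishes_near_def by blast
  then show ?thesis using \<beta>(1) by blast
qed

lemma coboundary_mult_inv_exact:
  fixes \<xi> :: "(nat \<Rightarrow> 'z) \<Rightarrow> 'r::{comm_ring,monoid_mult}"
  assumes \<xi>: "\<xi> \<in> carrier (C q)" and \<beta>: "\<beta> \<in> exact_cochains q"
  shows "\<delta> q (\<xi> \<otimes>\<^bsub>C q\<^esub> inv\<^bsub>C q\<^esub> \<beta>) = \<delta> q \<xi>"
proof -
  interpret group_hom "C q :: ((nat \<Rightarrow> 'z) \<Rightarrow> 'r) monoid" "C (Suc q)" "\<delta> q"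
    by (rule group_hom_coboundary)
  show ?thesis
    using \<xi> exact_cochain_closed[OF \<beta>] by (simp add: coboundary_exact_cochain[OF \<beta>])
qed

lemma exists_class_representative:
  fixes u :: "((nat \<Rightarrow> 'z) \<Rightarrow> 'r::{comm_ring,monoid_mult}) set set"
  assumes "u \<in> carrier (AS_cohomology Z a q)"
  shows "\<exists>\<xi>\<in>cocycles_mod_locally_zero q. AS_class Z a q \<xi> = u \<and> vanishes_near Z q a \<xi>"
proof -
  interpret comm_group "C q :: ((nat \<Rightarrow> 'z) \<Rightarrow> 'r) monoid" by (rule comm_group_cochains)
  obtain \<eta> :: "(nat \<Rightarrow> 'z) \<Rightarrow> 'r"
    where \<eta>: "\<eta> \<in> cocycles_mod_locally_zero q" and u: "u = AS_class Z a q \<eta>"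
    using assms unfolding carrier_cohomology by blast
  have \<eta>C: "\<eta> \<in> carrier (C q)" and "vanishes_near Z (Suc q) a (\<delta> q \<eta>)"
    using \<eta> basepoint by (auto simp: cocycles_mod_locally_zero_def locally_zero_iff)
  then obtain \<beta> where \<beta>: "\<beta> \<in> exact_cochains q"
    and near: "vanishes_near Z q a (\<eta> \<otimes>\<^bsub>C q\<^esub> inv\<^bsub>C q\<^esub> \<beta>)"
    using cocycle_near_basepoint_is_exact by blast
  have \<beta>C: "\<beta> \<in> carrier (C q)"
    by (rule exact_cochain_closed[OF \<beta>])
  let ?\<xi> = "\<eta> \<otimes>\<^bsub>C q\<^esub> inv\<^bsub>C q\<^esub> \<beta>"
  have \<xi>: "?\<xi> \<in> cocycles_mod_locally_zero q"
    using \<eta> \<eta>C \<beta>C by (simp add: cocycles_mod_locally_zero_def coboundary_mult_inv_exact[OF \<eta>C \<beta>])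
  have "\<eta> = \<beta> \<otimes>\<^bsub>C q\<^esub> ?\<xi>"
    using \<eta>C \<beta>C m_lcomm[of \<beta> \<eta> "inv\<^bsub>C q\<^esub> \<beta>"] by simp
  also have "\<dots> = \<one>\<^bsub>C q\<^esub> \<otimes>\<^bsub>C q\<^esub> (\<beta> \<otimes>\<^bsub>C q\<^esub> ?\<xi>)"
    using \<eta>C \<beta>C by simp
  finally have "AS_class Z a q \<eta> = AS_class Z a q ?\<xi>"
    using class_eq_iff[OF \<eta> \<xi>] one_locally_zero \<beta> by blast
  then show ?thesis
    using \<xi> near u by auto
qed

end

section \<open>Series of iterates\<close>

definition map_tuple :: "nat \<Rightarrow> ('z \<Rightarrow> 'z) \<Rightarrow> (nat \<Rightarrow> 'z) \<Rightarrow> nat \<Rightarrow> 'z" where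
  "map_tuple q h t = (\<lambda>i\<in>{..q}. h (t i))"

lemma map_tuple_in_PiE: "t \<in> {..q} \<rightarrow>\<^sub>E U \<Longrightarrow> h ` U \<subseteq> V \<Longrightarrow> map_tuple q h t \<in> {..q} \<rightarrow>\<^sub>E V"
  by (auto simp: map_tuple_def PiE_iff)

lemma map_tuple_id: "t \<in> {..q} \<rightarrow>\<^sub>E U \<Longrightarrow> map_tuple q (\<lambda>x. x) t = t"
  by (rule extensionalityI[of _ "{..q}"]) (auto simp: map_tuple_def PiE_iff)

lemma map_tuple_funpow:
  "map_tuple q (g ^^ j) (map_tuple q (g ^^ k) t) = map_tuple q (g ^^ (j + k)) t"
  by (rule ext) (simp add: map_tuple_def funpow_add)

lemma omit_entry_map_tuple:
  "omit_entry q j (map_tuple (Suc q) h t) = map_tuple q h (omit_entry q j t)"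
  by (rule ext) (simp add: map_tuple_def omit_entry_def)

locale attractor =
  fixes Z :: "'z topology" and g :: "'z \<Rightarrow> 'z" and a :: 'z
  assumes continuous: "continuous_map Z Z g"
    and attracting: "global_asymptotically_stable_attractor Z g a"
begin

sublocale pointed_space Z a
  using attracting by unfold_locales (simp add: global_asymptotically_stable_attractor_def)

text \<open>
  Stability provides these neighbourhoods. A tuple whose entries have entered one stays inside, so
  that a cochain vanishing there contributes only finitely many terms to the series.
\<close>

definition trapping_neighbourhood :: "'z set \<Rightarrow> bool" where
  "trapping_neighbourhood P \<longleftrightarrow> P \<subseteq> topspace Z \<and> a \<in> Z interior_of P \<and> g ` P \<subseteq> P"

lemma continuous_funpow: "continuous_map Z Z (g ^^ n)"
proof (induction n)
  case 0
  show ?case by (simp add: id_def[symmetric])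
next
  case (Suc n)
  then show ?case using continuous_map_compose[OF Suc continuous] by (simp only: funpow.simps(2))
qed

lemma funpow_topspace: "(g ^^ n) ` topspace Z \<subseteq> topspace Z"
  using continuous_funpow by (auto simp: continuous_map_def)

lemma funpow_trapping: "trapping_neighbourhood P \<Longrightarrow> (g ^^ n) ` P \<subseteq> P"
  by (induction n) (auto simp: trapping_neighbourhood_def)

lemma basepoint_in_trapping: "trapping_neighbourhood P \<Longrightarrow> a \<in> P"
  using interior_of_subset[of Z P] by (auto simp: trapping_neighbourhood_def)

lemma trapping_tuple_topspace:
  "trapping_neighbourhood P \<Longrightarrow> t \<in> {..q} \<rightarrow>\<^sub>E P \<Longrightarrow> t \<in> {..q} \<rightarrow>\<^sub>E topspace Z"
  using PiE_mono[of "{..q}" "\<lambda>_. P" "\<lambda>_. topspace Z"] by (auto simp: trapping_neighbourhood_def)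

lemma vanishes_near_iff_trapping:
  "vanishes_near Z q a \<xi> \<longleftrightarrow> (\<exists>P. trapping_neighbourhood P \<and> (\<forall>t \<in> {..q} \<rightarrow>\<^sub>E P. \<xi> t = 0))"
proof
  assume "vanishes_near Z q a \<xi>"
  then obtain W where W: "openin Z W" "a \<in> W" "\<And>t. t \<in> {..q} \<rightarrow>\<^sub>E W \<Longrightarrow> \<xi> t = 0"
    by (auto simp: vanishes_near_def)
  have "neighbourhood_base_at a (\<lambda>P. g ` P \<subseteq> P) Z"
    using attracting by (simp add: global_asymptotically_stable_attractor_def)
  then obtain U P where P: "openin Z U" "g ` P \<subseteq> P" "a \<in> U" "U \<subseteq> P" "P \<subseteq> W"
    using W(1,2) unfolding neighbourhood_base_at_def by meson
  then have "trapping_neighbourhood P"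
    using interior_of_maximal[OF P(4,1)] openin_subset[OF W(1)]
    by (auto simp: trapping_neighbourhood_def)
  moreover have "\<forall>t \<in> {..q} \<rightarrow>\<^sub>E P. \<xi> t = 0"
    using W(3) PiE_mono[of "{..q}" "\<lambda>_. P" "\<lambda>_. W"] P(5) by blast
  ultimately show "\<exists>P. trapping_neighbourhood P \<and> (\<forall>t \<in> {..q} \<rightarrow>\<^sub>E P. \<xi> t = 0)"
    by blast
qed (auto simp: vanishes_near_iff_neighbourhood trapping_neighbourhood_def)

text \<open>
  A single number of iterations works for all entries: take the maximum of the entry times and use
  invariance for the entries that arrived earlier.
\<close>

lemma eventually_trapped:
  assumes P: "trapping_neighbourhood P" and t: "t \<in> {..q} \<rightarrow>\<^sub>E topspace Z"
  shows "\<exists>n. map_tuple q (g ^^ n) t \<in> {..q} \<rightarrow>\<^sub>E P"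
proof -
  have "\<exists>n. (g ^^ n) (t i) \<in> P" if "i \<in> {..q}" for i
    using attracting P that PiE_mem[OF t]
    by (auto simp: global_asymptotically_stable_attractor_def trapping_neighbourhood_def)
  then obtain n where n: "\<And>i. i \<in> {..q} \<Longrightarrow> (g ^^ n i) (t i) \<in> P"
    by metis
  define m where "m = Max (n ` {..q})"
  have "(g ^^ m) (t i) \<in> P" if i: "i \<in> {..q}" for i
  proof -
    have "m = (m - n i) + n i"
      using i by (simp add: m_def)
    then have "(g ^^ m) (t i) = (g ^^ (m - n i)) ((g ^^ n i) (t i))"
      by (metis funpow_add comp_apply)
    then show ?thesis
      using funpow_trapping[OF P, of "m - n i"] n[OF i] by auto
  qed
  then show ?thesis
    by (intro exI[of _ m]) (simp add: map_tuple_def)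
qed

text \<open>
  Any sufficiently late \<open>n\<close> may serve as the length of the sum. Identities between series are
  therefore proved at a tuple by choosing one \<open>n\<close> for all the series involved.
\<close>

lemma series_eq_finite_sum:
  fixes A :: "'r::{comm_ring,monoid_mult} fps"
  assumes P: "trapping_neighbourhood P" and zero: "\<And>t. t \<in> {..q} \<rightarrow>\<^sub>E P \<Longrightarrow> \<xi> t = 0"
    and t: "t \<in> {..q} \<rightarrow>\<^sub>E topspace Z" and n: "map_tuple q (g ^^ n) t \<in> {..q} \<rightarrow>\<^sub>E P"
  shows "series_cochain Z g q A \<xi> t = (\<Sum>j<n. fps_nth A j * \<xi> (map_tuple q (g ^^ j) t))"
proof -
  have tail: "\<xi> (map_tuple q (g ^^ j) t) = 0" if "n \<le> j" for j
    using map_tuple_in_PiE[OF n funpow_trapping[OF P, of "j - n"]] that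
    by (intro zero) (simp add: map_tuple_funpow)
  have "j < n" if "fps_nth A j * \<xi> (map_tuple q (g ^^ j) t) \<noteq> 0" for j
    using that tail[of j] by (cases "n \<le> j") simp_all
  then have "{j. fps_nth A j * \<xi> (map_tuple q (g ^^ j) t) \<noteq> 0} \<subseteq> {..<n}"
    by blast
  then have "Sum_any (\<lambda>j. fps_nth A j * \<xi> (map_tuple q (g ^^ j) t)) =
      (\<Sum>j<n. fps_nth A j * \<xi> (map_tuple q (g ^^ j) t))"
    by (intro Sum_any.expand_superset) auto
  then show ?thesis
    using t by (simp add: series_cochain_def topspace_tuple_space map_tuple_def)
qed

lemma series_zero_on_trapping:
  fixes A :: "'r::{comm_ring,monoid_mult} fps"
  assumes P: "trapping_neighbourhood P" and zero: "\<And>t. t \<in> {..q} \<rightarrow>\<^sub>E P \<Longrightarrow> \<xi> t = 0"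
    and t: "t \<in> {..q} \<rightarrow>\<^sub>E P"
  shows "series_cochain Z g q A \<xi> t = 0"
proof -
  note tZ = trapping_tuple_topspace[OF P t]
  have n: "map_tuple q (g ^^ 0) t \<in> {..q} \<rightarrow>\<^sub>E P"
    using t by (simp add: map_tuple_id id_def)
  then show ?thesis
    using series_eq_finite_sum[OF P zero tZ n] by simp
qed

lemma vanishes_near_series:
  fixes A :: "'r::{comm_ring,monoid_mult} fps"
  assumes "vanishes_near Z q a \<xi>"
  shows "vanishes_near Z q a (series_cochain Z g q A \<xi>)"
  using assms series_zero_on_trapping unfolding vanishes_near_iff_trapping by metis

lemma series_closed:
  fixes A :: "'r::{comm_ring,monoid_mult} fps"
  assumes "vanishes_near Z q a \<xi>"
  shows "series_cochain Z g q A \<xi> \<in> carrier (C q)"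
proof -
  obtain P where P: "trapping_neighbourhood P" "\<And>t. t \<in> {..q} \<rightarrow>\<^sub>E P \<Longrightarrow> \<xi> t = 0"
    using assms unfolding vanishes_near_iff_trapping by blast
  then have "series_cochain Z g q A \<xi> (const_tuple q a) = 0"
    using series_zero_on_trapping const_tuple_in_PiE[OF basepoint_in_trapping] by metis
  then show ?thesis
    unfolding cochain_iff by (simp add: series_cochain_def topspace_tuple_space)
qed

lemma series_of_fps_sum:
  fixes A B :: "'r::{comm_ring,monoid_mult} fps"
  assumes near: "vanishes_near Z q a \<xi>"
  shows "series_cochain Z g q (A + B) \<xi> = series_cochain Z g q A \<xi> \<otimes>\<^bsub>C q\<^esub> series_cochain Z g q B \<xi>"
proof (rule cochain_eqI)
  interpret comm_group "C q :: ((nat \<Rightarrow> 'z) \<Rightarrow> 'r) monoid" by (rule comm_group_cochains)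
  show "series_cochain Z g q A \<xi> \<otimes>\<^bsub>C q\<^esub> series_cochain Z g q B \<xi> \<in> carrier (C q)"
    using near by (simp add: series_closed)
  fix t assume t: "t \<in> {..q} \<rightarrow>\<^sub>E topspace Z"
  obtain P where P: "trapping_neighbourhood P" "\<And>t. t \<in> {..q} \<rightarrow>\<^sub>E P \<Longrightarrow> \<xi> t = 0"
    using near unfolding vanishes_near_iff_trapping by blast
  obtain n where n: "map_tuple q (g ^^ n) t \<in> {..q} \<rightarrow>\<^sub>E P"
    using eventually_trapped[OF P(1) t] by blast
  show "series_cochain Z g q (A + B) \<xi> t =
      (series_cochain Z g q A \<xi> \<otimes>\<^bsub>C q\<^esub> series_cochain Z g q B \<xi>) t"
    using t by (simp add: mult_cochain_apply series_eq_finite_sum[OF P t n] distrib_right sum.distrib)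
qed (rule series_closed[OF near])

lemma series_of_cochain_sum:
  fixes A :: "'r::{comm_ring,monoid_mult} fps"
  assumes \<xi>: "vanishes_near Z q a \<xi>" and \<eta>: "vanishes_near Z q a \<eta>"
  shows "series_cochain Z g q A (\<xi> \<otimes>\<^bsub>C q\<^esub> \<eta>) = series_cochain Z g q A \<xi> \<otimes>\<^bsub>C q\<^esub> series_cochain Z g q A \<eta>"
proof (rule cochain_eqI)
  interpret comm_group "C q :: ((nat \<Rightarrow> 'z) \<Rightarrow> 'r) monoid" by (rule comm_group_cochains)
  show "series_cochain Z g q A \<xi> \<otimes>\<^bsub>C q\<^esub> series_cochain Z g q A \<eta> \<in> carrier (C q)"
    using \<xi> \<eta> by (simp add: series_closed)
  show "series_cochain Z g q A (\<xi> \<otimes>\<^bsub>C q\<^esub> \<eta>) \<in> carrier (C q)"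
    by (rule series_closed[OF vanishes_near_mult[OF \<xi> \<eta>]])
  fix t assume t: "t \<in> {..q} \<rightarrow>\<^sub>E topspace Z"
  \<comment> \<open>This function is zero exactly where both cochains are, which gives one trapping neighbourhood for both.\<close>
  have "vanishes_near Z q a (\<lambda>t. if \<xi> t = 0 then \<eta> t else \<xi> t)"
    by (rule vanishes_near_combine[OF \<xi> \<eta>]) simp
  then obtain P where P: "trapping_neighbourhood P" and "\<forall>t \<in> {..q} \<rightarrow>\<^sub>E P. (if \<xi> t = 0 then \<eta> t else \<xi> t) = 0"
    unfolding vanishes_near_iff_trapping by blast
  then have zero: "\<xi> t = 0" "\<eta> t = 0" if "t \<in> {..q} \<rightarrow>\<^sub>E P" for t
    using that by (metis (full_types))+
  have zero_sum: "(\<xi> \<otimes>\<^bsub>C q\<^esub> \<eta>) s = 0" if "s \<in> {..q} \<rightarrow>\<^sub>E P" for s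
    using zero[OF that] trapping_tuple_topspace[OF P that] by (simp add: mult_cochain_apply)
  obtain n where n: "map_tuple q (g ^^ n) t \<in> {..q} \<rightarrow>\<^sub>E P"
    using eventually_trapped[OF P t] by blast
  show "series_cochain Z g q A (\<xi> \<otimes>\<^bsub>C q\<^esub> \<eta>) t =
      (series_cochain Z g q A \<xi> \<otimes>\<^bsub>C q\<^esub> series_cochain Z g q A \<eta>) t"
    using t map_tuple_in_PiE[OF t funpow_topspace]
    by (simp add: mult_cochain_apply series_eq_finite_sum[OF P zero(1) t n]
        series_eq_finite_sum[OF P zero(2) t n] series_eq_finite_sum[OF P zero_sum t n]
        distrib_left sum.distrib)
qed

text \<open>
  Once all entries of a tuple are trapped, so are the entries of its faces; the sums over the faces
  and over the iterates are then both finite and can be interchanged.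
\<close>

lemma coboundary_series:
  fixes A :: "'r::{comm_ring,monoid_mult} fps"
  assumes near: "vanishes_near Z q a \<xi>"
  shows "\<delta> q (series_cochain Z g q A \<xi>) = series_cochain Z g (Suc q) A (\<delta> q \<xi>)"
proof (rule cochain_eqI)
  show "\<delta> q (series_cochain Z g q A \<xi>) \<in> carrier (C (Suc q))"
    by (rule coboundary_closed[OF series_closed[OF near]])
  show "series_cochain Z g (Suc q) A (\<delta> q \<xi>) \<in> carrier (C (Suc q))"
    by (rule series_closed[OF vanishes_near_coboundary[OF near]])
  fix t assume t: "t \<in> {..Suc q} \<rightarrow>\<^sub>E topspace Z"
  obtain P where P: "trapping_neighbourhood P" and zero: "\<And>t. t \<in> {..q} \<rightarrow>\<^sub>E P \<Longrightarrow> \<xi> t = 0"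
    using near unfolding vanishes_near_iff_trapping by blast
  have \<delta>_zero: "\<delta> q \<xi> s = 0" if s: "s \<in> {..Suc q} \<rightarrow>\<^sub>E P" for s
    using trapping_tuple_topspace[OF P s] zero[OF omit_entry_in_PiE[OF s]]
    by (simp add: AS_coboundary_def topspace_tuple_space del: sum.atMost_Suc)
  obtain n where n: "map_tuple (Suc q) (g ^^ n) t \<in> {..Suc q} \<rightarrow>\<^sub>E P"
    using eventually_trapped[OF P t] by blast
  have "map_tuple q (g ^^ n) (omit_entry q j t) \<in> {..q} \<rightarrow>\<^sub>E P" for j
    using omit_entry_in_PiE[OF n] by (simp add: omit_entry_map_tuple)
  note face = series_eq_finite_sum[OF P zero omit_entry_in_PiE[OF t] this]
  have "\<delta> q (series_cochain Z g q A \<xi>) t =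
      (\<Sum>j\<le>Suc q. \<Sum>k<n. (- 1) ^ j * (fps_nth A k * \<xi> (map_tuple q (g ^^ k) (omit_entry q j t))))"
    using t by (simp add: AS_coboundary_def topspace_tuple_space face sum_distrib_left del: sum.atMost_Suc)
  also have "\<dots> =
      (\<Sum>k<n. \<Sum>j\<le>Suc q. (- 1) ^ j * (fps_nth A k * \<xi> (map_tuple q (g ^^ k) (omit_entry q j t))))"
    by (rule sum.swap)
  also have "\<dots> = (\<Sum>k<n. fps_nth A k * \<delta> q \<xi> (map_tuple (Suc q) (g ^^ k) t))"
    using map_tuple_in_PiE[OF t funpow_topspace]
    by (simp add: AS_coboundary_def topspace_tuple_space omit_entry_map_tuple sum_distrib_left
        mult.left_commute del: sum.atMost_Suc)
  also have "\<dots> = series_cochain Z g (Suc q) A (\<delta> q \<xi>) t"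
    by (rule series_eq_finite_sum[OF P \<delta>_zero t n, symmetric])
  finally show "\<delta> q (series_cochain Z g q A \<xi>) t = series_cochain Z g (Suc q) A (\<delta> q \<xi>) t" .
qed

text \<open>
  By continuity all points near \<open>z\<close> are trapped after the same number \<open>n\<close> of iterations, so near \<open>z\<close>
  the series is the sum of its first \<open>n\<close> terms. The \<open>j\<close>-th term vanishes near \<open>z\<close> because \<open>\<xi>\<close> vanishes
  near \<open>g\<^sup>j(z)\<close>.
\<close>

lemma series_locally_zero:
  fixes A :: "'r::{comm_ring,monoid_mult} fps"
  assumes \<xi>: "\<xi> \<in> L q"
  shows "series_cochain Z g q A \<xi> \<in> L q"
proof -
  have near: "vanishes_near Z q a \<xi>"
    using \<xi> basepoint by (simp add: locally_zero_iff)
  obtain P where P: "trapping_neighbourhood P" and zero: "\<And>t. t \<in> {..q} \<rightarrow>\<^sub>E P \<Longrightarrow> \<xi> t = 0"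
    using near unfolding vanishes_near_iff_trapping by blast
  have "vanishes_near Z q z (series_cochain Z g q A \<xi>)" if z: "z \<in> topspace Z" for z
  proof -
    have "a \<in> Z interior_of (Z interior_of P)"
      using P by (simp add: trapping_neighbourhood_def)
    then obtain n where n: "(g ^^ n) z \<in> Z interior_of P"
      using attracting z unfolding global_asymptotically_stable_attractor_def by metis
    have "\<exists>U. openin Z U \<and> (g ^^ j) z \<in> U \<and> (\<forall>t \<in> {..q} \<rightarrow>\<^sub>E U. \<xi> t = 0)" for j
      using \<xi> z funpow_topspace[of j] by (auto simp: locally_zero_iff vanishes_near_def)
    then obtain U where U: "\<And>j. openin Z (U j)" "\<And>j. (g ^^ j) z \<in> U j"
      "\<And>j t. t \<in> {..q} \<rightarrow>\<^sub>E U j \<Longrightarrow> \<xi> t = 0"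
      by metis
    define pre where "pre j V = {x \<in> topspace Z. (g ^^ j) x \<in> V}" for j V
    have open_pre: "openin Z (pre j V)" if "openin Z V" for j V
      unfolding pre_def by (rule openin_continuous_map_preimage[OF continuous_funpow that])
    define W where "W = \<Inter>(insert (pre n (Z interior_of P)) ((\<lambda>j. pre j (U j)) ` {..<n}))"
    have "openin Z W"
      unfolding W_def by (rule openin_Inter) (auto intro: open_pre U(1))
    moreover have "z \<in> W"
      using z n U(2) by (auto simp: W_def pre_def)
    moreover have "series_cochain Z g q A \<xi> t = 0" if t: "t \<in> {..q} \<rightarrow>\<^sub>E W" for t
    proof -
      have W: "t i \<in> topspace Z" "(g ^^ n) (t i) \<in> P" "\<And>j. j < n \<Longrightarrow> (g ^^ j) (t i) \<in> U j"
        if "i \<in> {..q}" for i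
        using PiE_mem[OF t that] interior_of_subset[of Z P] by (auto simp: W_def pre_def)
      have tZ: "t \<in> {..q} \<rightarrow>\<^sub>E topspace Z"
        using t W(1) by (simp add: PiE_iff)
      have "map_tuple q (g ^^ n) t \<in> {..q} \<rightarrow>\<^sub>E P"
        using W(2) by (simp add: map_tuple_def)
      note series_eq_finite_sum[OF P zero tZ this, where A = A]
      moreover have "\<xi> (map_tuple q (g ^^ j) t) = 0" if "j < n" for j
        by (rule U(3)[of _ j]) (use W(3) that in \<open>simp add: map_tuple_def\<close>)
      ultimately show ?thesis by simp
    qed
    ultimately show ?thesis
      unfolding vanishes_near_def by blast
  qed
  then show ?thesis
    by (simp add: locally_zero_iff series_closed[OF near])
qed

text \<open>
  The value at \<open>t\<close> is the sum of \<open>a\<^sub>j b\<^sub>k \<xi>(g\<^sup>j\<^sup>+\<^sup>k t)\<close>; collecting the terms with \<open>j + k = m\<close> gives the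
  coefficient of the product series.
\<close>

lemma series_of_fps_product:
  fixes A B :: "'r::{comm_ring,monoid_mult} fps"
  assumes near: "vanishes_near Z q a \<xi>"
  shows "series_cochain Z g q A (series_cochain Z g q B \<xi>) = series_cochain Z g q (A * B) \<xi>"
proof (rule cochain_eqI)
  show "series_cochain Z g q A (series_cochain Z g q B \<xi>) \<in> carrier (C q)"
    by (rule series_closed[OF vanishes_near_series[OF near]])
  show "series_cochain Z g q (A * B) \<xi> \<in> carrier (C q)"
    by (rule series_closed[OF near])
  fix t assume t: "t \<in> {..q} \<rightarrow>\<^sub>E topspace Z"
  obtain P where P: "trapping_neighbourhood P" and zero: "\<And>t. t \<in> {..q} \<rightarrow>\<^sub>E P \<Longrightarrow> \<xi> t = 0"
    using near unfolding vanishes_near_iff_trapping by blast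
  note zero' = series_zero_on_trapping[OF P zero]
  obtain n where n: "map_tuple q (g ^^ n) t \<in> {..q} \<rightarrow>\<^sub>E P"
    using eventually_trapped[OF P t] by blast
  have later: "map_tuple q (g ^^ (j + n)) t \<in> {..q} \<rightarrow>\<^sub>E P" for j
    using map_tuple_in_PiE[OF n funpow_trapping[OF P, of j]] by (simp add: map_tuple_funpow)
  define x where "x m = \<xi> (map_tuple q (g ^^ m) t)" for m
  have x_zero: "x m = 0" if "n \<le> m" for m
    using zero[OF later[of "m - n"]] that by (simp add: x_def)
  \<comment> \<open>Iterates from the \<open>n\<close>-th on are trapped, so the sum over a square reduces to one over a triangle.\<close>
  have triangle: "j + k < n" if "fps_nth A j * (fps_nth B k * x (j + k)) \<noteq> 0" for j k
    using that x_zero[of "j + k"] by (cases "n \<le> j + k") simp_all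
  have inner: "series_cochain Z g q B \<xi> (map_tuple q (g ^^ j) t) = (\<Sum>k<n. fps_nth B k * x (j + k))" for j
  proof -
    have "map_tuple q (g ^^ n) (map_tuple q (g ^^ j) t) \<in> {..q} \<rightarrow>\<^sub>E P"
      using later[of j] by (simp add: map_tuple_funpow add.commute)
    then show ?thesis
      using series_eq_finite_sum[OF P zero map_tuple_in_PiE[OF t funpow_topspace], where n = n and A = B]
      by (simp add: map_tuple_funpow x_def add.commute)
  qed
  have "series_cochain Z g q A (series_cochain Z g q B \<xi>) t =
      (\<Sum>j<n. fps_nth A j * (\<Sum>k<n. fps_nth B k * x (j + k)))"
    by (simp add: series_eq_finite_sum[OF P zero' t n] inner)
  also have "\<dots> = (\<Sum>(j, k)\<in>{..<n} \<times> {..<n}. fps_nth A j * (fps_nth B k * x (j + k)))"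
    by (simp add: sum_distrib_left sum.cartesian_product)
  also have "\<dots> = (\<Sum>(j, k)\<in>{(j, k). j + k < n}. fps_nth A j * (fps_nth B k * x (j + k)))"
    by (rule sum.mono_neutral_right) (auto intro: triangle)
  also have "\<dots> = (\<Sum>m<n. \<Sum>j\<le>m. fps_nth A j * (fps_nth B (m - j) * x (j + (m - j))))"
    by (rule sum.triangle_reindex)
  also have "\<dots> = (\<Sum>m<n. fps_nth (A * B) m * x m)"
    by (simp add: fps_mult_nth atLeast0AtMost sum_distrib_right mult.assoc)
  also have "\<dots> = series_cochain Z g q (A * B) \<xi> t"
    by (simp add: series_eq_finite_sum[OF P zero t n] x_def)
  finally show "series_cochain Z g q A (series_cochain Z g q B \<xi>) t =
      series_cochain Z g q (A * B) \<xi> t" .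
qed

text \<open>
  If \<open>\<beta> = \<delta> \<eta>\<close> vanishes near \<open>a\<close>, the series need not make sense for \<open>\<eta>\<close>, which is only a cocycle
  near \<open>a\<close>. Contracting it replaces \<open>\<eta>\<close> by a cochain that vanishes near \<open>a\<close> and has the same
  coboundary.
\<close>

lemma series_exact:
  fixes A :: "'r::{comm_ring,monoid_mult} fps"
  assumes \<beta>: "\<beta> \<in> exact_cochains q" and near: "vanishes_near Z q a \<beta>"
  shows "series_cochain Z g q A \<beta> \<in> exact_cochains q"
proof (cases q)
  case 0
  have "series_cochain Z g 0 A \<beta> = \<one>\<^bsub>C 0\<^esub>"
  proof (rule cochain_eqI)
    show "series_cochain Z g 0 A \<beta> \<in> carrier (C 0)"
      using series_closed[OF near] by (simp add: 0)
    show "\<one>\<^bsub>C 0\<^esub> \<in> carrier (C 0)"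
      by (rule one_cochain_closed)
    fix t :: "nat \<Rightarrow> 'z" assume t: "t \<in> {..0} \<rightarrow>\<^sub>E topspace Z"
    have "\<beta> (map_tuple 0 (g ^^ j) t) = 0" for j
      using \<beta> one_cochain_apply[OF map_tuple_in_PiE[OF t funpow_topspace]]
      by (simp add: 0 exact_cochains_0)
    then show "series_cochain Z g 0 A \<beta> t = \<one>\<^bsub>C 0\<^esub> t"
      using t by (simp add: series_cochain_def topspace_tuple_space one_cochain_apply map_tuple_def)
  qed
  then show ?thesis
    by (simp add: 0 exact_cochains_0)
next
  case (Suc p)
  interpret comm_group "C p :: ((nat \<Rightarrow> 'z) \<Rightarrow> 'r) monoid" by (rule comm_group_cochains)
  obtain \<eta> where \<eta>: "\<eta> \<in> carrier (C p)" "\<beta> = \<delta> p \<eta>"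
    using \<beta> by (auto simp: Suc exact_cochains_Suc)
  obtain \<gamma> where \<gamma>: "\<gamma> \<in> exact_cochains p"
    and near': "vanishes_near Z p a (\<eta> \<otimes>\<^bsub>C p\<^esub> inv\<^bsub>C p\<^esub> \<gamma>)"
    using cocycle_near_basepoint_is_exact[OF \<eta>(1)] near \<eta>(2) Suc by blast
  have "\<beta> = \<delta> p (\<eta> \<otimes>\<^bsub>C p\<^esub> inv\<^bsub>C p\<^esub> \<gamma>)"
    using coboundary_mult_inv_exact[OF \<eta>(1) \<gamma>] \<eta>(2) by simp
  then have "series_cochain Z g q A \<beta> = \<delta> p (series_cochain Z g p A (\<eta> \<otimes>\<^bsub>C p\<^esub> inv\<^bsub>C p\<^esub> \<gamma>))"
    by (simp add: Suc coboundary_series[OF near'])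
  then show ?thesis
    by (auto simp: Suc exact_cochains_Suc series_closed[OF near'])
qed

section \<open>The operator of a power series\<close>

lemma representatives_iff:
  "\<xi> \<in> representatives_vanishing_near Z a q u \<longleftrightarrow>
     \<xi> \<in> cocycles_mod_locally_zero q \<and> AS_class Z a q \<xi> = u \<and> vanishes_near Z q a \<xi>"
  by (auto simp: representatives_vanishing_near_def cocycles_mod_locally_zero_def
      vanishes_near_iff_neighbourhood)

lemma series_cocycle:
  fixes A :: "'r::{comm_ring,monoid_mult} fps"
  assumes "\<xi> \<in> cocycles_mod_locally_zero q" and "vanishes_near Z q a \<xi>"
  shows "series_cochain Z g q A \<xi> \<in> cocycles_mod_locally_zero q"
  using assms
  by (simp add: cocycles_mod_locally_zero_def series_closed coboundary_series series_locally_zero)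

text \<open>
  Two representatives differ by a locally zero and an exact cochain. The
  representatives and the locally zero part vanish near \<open>a\<close>, hence so does the exact part, and the
  series can be applied to each part separately.
\<close>

lemma class_series_cong:
  fixes A :: "'r::{comm_ring,monoid_mult} fps"
  assumes \<xi>: "\<xi> \<in> cocycles_mod_locally_zero q" "vanishes_near Z q a \<xi>"
    and \<eta>: "\<eta> \<in> cocycles_mod_locally_zero q" "vanishes_near Z q a \<eta>"
    and eq: "AS_class Z a q \<xi> = AS_class Z a q \<eta>"
  shows "AS_class Z a q (series_cochain Z g q A \<xi>) = AS_class Z a q (series_cochain Z g q A \<eta>)"
proof -
  interpret comm_group "C q :: ((nat \<Rightarrow> 'z) \<Rightarrow> 'r) monoid" by (rule comm_group_cochains)
  obtain \<nu> \<beta> where \<nu>: "\<nu> \<in> L q" and \<beta>: "\<beta> \<in> exact_cochains q"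
    and \<xi>_eq: "\<xi> = \<nu> \<otimes>\<^bsub>C q\<^esub> (\<beta> \<otimes>\<^bsub>C q\<^esub> \<eta>)"
    using eq class_eq_iff[OF \<xi>(1) \<eta>(1)] by blast
  have near_\<nu>: "vanishes_near Z q a \<nu>"
    using \<nu> basepoint by (simp add: locally_zero_iff)
  have "vanishes_near Z q a (\<nu> \<otimes>\<^bsub>C q\<^esub> \<eta>)"
    by (rule vanishes_near_mult[OF near_\<nu> \<eta>(2)])
  then have near_\<beta>: "vanishes_near Z q a \<beta>"
  proof (rule vanishes_near_combine[OF \<xi>(2)])
    fix t assume "t \<in> {..q} \<rightarrow>\<^sub>E topspace Z" "\<xi> t = 0" "(\<nu> \<otimes>\<^bsub>C q\<^esub> \<eta>) t = 0"
    then show "\<beta> t = 0"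
      unfolding \<xi>_eq by (simp add: mult_cochain_apply add.left_commute)
  qed
  have "series_cochain Z g q A \<xi> = series_cochain Z g q A \<nu> \<otimes>\<^bsub>C q\<^esub>
      (series_cochain Z g q A \<beta> \<otimes>\<^bsub>C q\<^esub> series_cochain Z g q A \<eta>)"
    unfolding \<xi>_eq
    by (simp add: series_of_cochain_sum near_\<nu> near_\<beta> \<eta>(2) vanishes_near_mult)
  then show ?thesis
    by (intro class_eq_iff[OF series_cocycle[OF \<xi>] series_cocycle[OF \<eta>], THEN iffD2]
        bexI[OF _ series_locally_zero[OF \<nu>]] bexI[OF _ series_exact[OF \<beta> near_\<beta>]])
qed

text \<open>
  Evaluates the definite description: any representative vanishing near \<open>a\<close> may be used.
\<close>

lemma power_series_operator_eq:
  fixes A :: "'r::{comm_ring,monoid_mult} fps"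
  assumes \<xi>: "\<xi> \<in> representatives_vanishing_near Z a q u"
  shows "power_series_operator Z g a q A u = AS_class Z a q (series_cochain Z g q A \<xi>)"
  unfolding power_series_operator_def
proof (rule the_equality)
  show "\<exists>\<eta>\<in>representatives_vanishing_near Z a q u.
      AS_class Z a q (series_cochain Z g q A \<xi>) = AS_class Z a q (series_cochain Z g q A \<eta>)"
    by (rule bexI[OF _ \<xi>]) (rule refl)
  fix c assume "\<exists>\<eta>\<in>representatives_vanishing_near Z a q u. c = AS_class Z a q (series_cochain Z g q A \<eta>)"
  then obtain \<eta> where \<eta>: "\<eta> \<in> representatives_vanishing_near Z a q u"
    and c: "c = AS_class Z a q (series_cochain Z g q A \<eta>)" ..
  show "c = AS_class Z a q (series_cochain Z g q A \<xi>)"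
    unfolding c by (rule class_series_cong) (use \<xi> \<eta> in \<open>simp_all add: representatives_iff\<close>)
qed

text \<open>
  This makes compositions computable: the series of a representative can be fed into the next
  operator without changing the representative.
\<close>

lemma series_representative:
  fixes A :: "'r::{comm_ring,monoid_mult} fps"
  assumes \<xi>: "\<xi> \<in> representatives_vanishing_near Z a q u"
  shows "series_cochain Z g q A \<xi> \<in> representatives_vanishing_near Z a q (power_series_operator Z g a q A u)"
  using \<xi> power_series_operator_eq[OF \<xi>, of A]
  by (simp add: representatives_iff series_cocycle vanishes_near_series)

lemma power_series_operator_add:
  fixes A B :: "'r::{comm_ring,monoid_mult} fps"
  assumes "u \<in> carrier (AS_cohomology Z a q)"
  shows "power_series_operator Z g a q (A + B) u =
    power_series_operator Z g a q A u \<otimes>\<^bsub>AS_cohomology Z a q\<^esub> power_series_operator Z g a q B u"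
proof -
  obtain \<xi> where \<xi>: "\<xi> \<in> representatives_vanishing_near Z a q u"
    using exists_class_representative[OF assms] unfolding representatives_iff by blast
  then show ?thesis
    by (simp add: power_series_operator_eq[OF \<xi>] representatives_iff series_of_fps_sum mult_class series_cocycle)
qed

lemma power_series_operator_mult:
  fixes A B :: "'r::{comm_ring,monoid_mult} fps"
  assumes "u \<in> carrier (AS_cohomology Z a q)"
  shows "power_series_operator Z g a q (A * B) u =
    power_series_operator Z g a q A (power_series_operator Z g a q B u)"
proof -
  obtain \<xi> where \<xi>: "\<xi> \<in> representatives_vanishing_near Z a q u"
    using exists_class_representative[OF assms] unfolding representatives_iff by blast
  then have "vanishes_near Z q a \<xi>"
    by (simp add: representatives_iff)
  then show ?thesis
    unfolding power_series_operator_eq[OF \<xi>, of "A * B"]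
      power_series_operator_eq[OF series_representative[OF \<xi>]]
    by (simp add: series_of_fps_product)
qed

end

theorem proposition33:
  fixes Z :: "'z topology" and g :: "'z \<Rightarrow> 'z" and a :: 'z and q :: nat
    and A B :: "'r::{comm_ring,monoid_mult} fps"
  assumes "paracompact_space Z" and "Hausdorff_space Z"
    and "continuous_map Z Z g"
    and "global_asymptotically_stable_attractor Z g a"
  shows "(\<forall>u \<in> carrier (AS_cohomology Z a q).
            power_series_operator Z g a q (A + B) u =
            power_series_operator Z g a q A u \<otimes>\<^bsub>AS_cohomology Z a q\<^esub> power_series_operator Z g a q B u) \<and>
         (\<forall>u \<in> carrier (AS_cohomology Z a q).
            power_series_operator Z g a q (A * B) u =
            power_series_operator Z g a q A (power_series_operator Z g a q B u))"
proof -
  interpret attractor Z g a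
    using assms(3,4) by unfold_locales
  show ?thesis
    using power_series_operator_add power_series_operator_mult by blast
qed

end
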